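(* Let $\mathcal{A}$ be a von Neumann algebra acting on a Hilbert space $H$ and let $T,S\in\mathcal{A}$ be such that $\operatorname{Im}T$, $\operatorname{Im}S$ and $\operatorname{Im}ST$ are closed. Then there exist closed subspaces $H_1$ and $H_2$ of $H$ such that $P_{H_1},P_{H_2}\in\mathcal{A}$, $$\ker ST=\ker T\oplus H_1,\quad (\operatorname{Im}ST)^{\perp}=(\operatorname{Im}S)^{\perp}\oplus H_2,\quad P_{H_1}\preceq P_{\ker S}\quad\text{and}\quad P_{H_2}\preceq P_{(\operatorname{Im}T)^{\perp}}.$$ Moreover, if $P_{\ker T}\sim P_{(\operatorname{Im}T)^{\perp}}$ and $P_{\ker S}\sim P_{(\operatorname{Im}S)^{\perp}}$, then $P_{\ker ST}\sim P_{(\operatorname{Im}ST)^{\perp}}$.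
   Context: $P_L$ denotes the orthogonal projection onto a closed subspace $L\subseteq H$, and $\oplus$ denotes orthogonal direct sum. For projections $P,Q\in\mathcal{A}$: $P\sim Q$ means there is $V\in\mathcal{A}$ with $VV^*=P$, $V^*V=Q$; $P\preceq Q$ means there is a projection $P'\in\mathcal{A}$ with $P'\le Q$ and $P\sim P'$. *)

theory Defs
  imports "HOL-Analysis.Analysis"
begin

text \<open>
  Complex Hilbert spaces. Norm, metric and topology are those of the underlying real inner product
  \<open>Re \<langle>x, y\<rangle>\<close>, so that \<open>(norm x)\<^sup>2 = \<langle>x, x\<rangle>\<close>; positive definiteness is inherited from
  \<^class>\<open>real_inner\<close>.
\<close>

class chilbert_space = real_inner + complete_space +
  fixes scaleC :: "complex \<Rightarrow> 'a \<Rightarrow> 'a"  (infixr \<open>*\<^sub>C\<close> 75)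
    and cinner :: "'a \<Rightarrow> 'a \<Rightarrow> complex"
  assumes scaleC_add_right: "c *\<^sub>C (x + y) = c *\<^sub>C x + c *\<^sub>C y"
    and scaleC_add_left: "(c + d) *\<^sub>C x = c *\<^sub>C x + d *\<^sub>C x"
    and scaleC_scaleC: "c *\<^sub>C (d *\<^sub>C x) = (c * d) *\<^sub>C x"
    and scaleC_one: "1 *\<^sub>C x = x"
    and scaleR_scaleC: "r *\<^sub>R x = complex_of_real r *\<^sub>C x"
    and cinner_commute: "cinner x y = cnj (cinner y x)"
    and cinner_add_left: "cinner (x + y) z = cinner x z + cinner y z"
    and cinner_scaleC_left: "cinner (c *\<^sub>C x) y = c * cinner x y"
    and inner_eq_Re_cinner: "inner x y = Re (cinner x y)"

instantiation complex :: chilbert_space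
begin

definition scaleC_complex :: "complex \<Rightarrow> complex \<Rightarrow> complex"
  where "scaleC_complex c x = c * x"

definition cinner_complex :: "complex \<Rightarrow> complex \<Rightarrow> complex"
  where "cinner_complex x y = x * cnj y"

instance
  by standard
    (auto simp: scaleC_complex_def cinner_complex_def inner_complex_def scaleR_conv_of_real
      algebra_simps)

end

definition closed_csubspace :: "'a::chilbert_space set \<Rightarrow> bool"
  where "closed_csubspace L \<longleftrightarrow>
    0 \<in> L \<and> (\<forall>x\<in>L. \<forall>y\<in>L. x + y \<in> L) \<and> (\<forall>c. \<forall>x\<in>L. c *\<^sub>C x \<in> L) \<and> closed L"

definition orth_compl :: "'a::chilbert_space set \<Rightarrow> 'a set"
  where "orth_compl L = {x. \<forall>y\<in>L. cinner x y = 0}"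

definition is_orth_sum :: "'a::chilbert_space set \<Rightarrow> 'a set \<Rightarrow> 'a set \<Rightarrow> bool"
  where "is_orth_sum M K L \<longleftrightarrow>
    (\<forall>x\<in>K. \<forall>y\<in>L. cinner x y = 0) \<and> M = {x + y | x y. x \<in> K \<and> y \<in> L}"

text \<open>Meaningful when \<open>L\<close> is a closed subspace, where the described vector exists and is unique.\<close>

definition Proj :: "'a::chilbert_space set \<Rightarrow> 'a \<Rightarrow> 'a"
  where "Proj L x = (THE y. y \<in> L \<and> x - y \<in> orth_compl L)"

definition bounded_clinear :: "('a::chilbert_space \<Rightarrow> 'a) \<Rightarrow> bool"
  where "bounded_clinear T \<longleftrightarrow> bounded_linear T \<and> (\<forall>c x. T (c *\<^sub>C x) = c *\<^sub>C T x)"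

definition ker :: "('a::chilbert_space \<Rightarrow> 'a) \<Rightarrow> 'a set"
  where "ker T = {x. T x = 0}"

text \<open>Meaningful for bounded operators, where existence is the Riesz representation theorem.\<close>

definition adj :: "('a::chilbert_space \<Rightarrow> 'a) \<Rightarrow> 'a \<Rightarrow> 'a"
  where "adj T = (THE R. \<forall>x y. cinner (T x) y = cinner x (R y))"

definition commutant :: "('a::chilbert_space \<Rightarrow> 'a) set \<Rightarrow> ('a \<Rightarrow> 'a) set"
  where "commutant A = {B. bounded_clinear B \<and> (\<forall>T\<in>A. B \<circ> T = T \<circ> B)}"

text \<open>
  Dixmier's and Takesaki's definition: a *-subalgebra of the bounded operators that equals its
  bicommutant. In particular it contains the identity of the whole space.
\<close>

definition von_neumann_algebra :: "('a::chilbert_space \<Rightarrow> 'a) set \<Rightarrow> bool"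
  where "von_neumann_algebra A \<longleftrightarrow>
    (\<forall>T\<in>A. bounded_clinear T) \<and>
    (\<forall>S\<in>A. \<forall>T\<in>A. (\<lambda>x. S x + T x) \<in> A) \<and>
    (\<forall>c. \<forall>T\<in>A. (\<lambda>x. c *\<^sub>C T x) \<in> A) \<and>
    (\<forall>S\<in>A. \<forall>T\<in>A. S \<circ> T \<in> A) \<and>
    (\<forall>T\<in>A. adj T \<in> A) \<and>
    commutant (commutant A) = A"

definition is_projection :: "('a::chilbert_space \<Rightarrow> 'a) \<Rightarrow> bool"
  where "is_projection P \<longleftrightarrow> bounded_clinear P \<and> P \<circ> P = P \<and> adj P = P"

definition op_le :: "('a::chilbert_space \<Rightarrow> 'a) \<Rightarrow> ('a \<Rightarrow> 'a) \<Rightarrow> bool"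
  where "op_le P Q \<longleftrightarrow>
    (\<forall>x. cinner (Q x - P x) x \<in> \<real> \<and> 0 \<le> Re (cinner (Q x - P x) x))"

text \<open>Murray--von Neumann equivalence and subequivalence of projections \<open>P\<close>, \<open>Q\<close> in \<open>A\<close>.\<close>

definition mvn_equiv ::
    "('a::chilbert_space \<Rightarrow> 'a) set \<Rightarrow> ('a \<Rightarrow> 'a) \<Rightarrow> ('a \<Rightarrow> 'a) \<Rightarrow> bool"
  where "mvn_equiv A P Q \<longleftrightarrow> (\<exists>V\<in>A. V \<circ> adj V = P \<and> adj V \<circ> V = Q)"

definition mvn_subequiv ::
    "('a::chilbert_space \<Rightarrow> 'a) set \<Rightarrow> ('a \<Rightarrow> 'a) \<Rightarrow> ('a \<Rightarrow> 'a) \<Rightarrow> bool"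
  where "mvn_subequiv A P Q \<longleftrightarrow>
    (\<exists>P'\<in>A. is_projection P' \<and> op_le P' Q \<and> mvn_equiv A P P')"

end

theory Submission
  imports Defs
begin

text \<open>
  Put \<open>M = ker S\<close>, \<open>N = (Im T)\<^sup>\<bottom>\<close>, \<open>H1 = ker ST \<inter> (ker T)\<^sup>\<bottom>\<close> and, dually,
  \<open>H2 = ker T*S* \<inter> (ker S* )\<^sup>\<bottom>\<close>. For every operator \<open>W\<close> in the algebra, polar decomposition gives
  \<open>P\<close> of \<open>(ker W)\<^sup>\<bottom>\<close> equivalent to \<open>P\<close> of the closure of \<open>Im W\<close>. Applied to the restrictions of \<open>T\<close> to
  \<open>H1\<close> and of \<open>S*\<close> to \<open>H2\<close>, this shows that \<open>H1\<close> and \<open>H2\<close> are equivalent to \<open>M \<inter> N\<^sup>\<bottom>\<close> and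
  \<open>N \<inter> M\<^sup>\<bottom>\<close> respectively; equality rather than inclusion of the images rests on \<open>Im T\<close> and \<open>Im ST\<close>
  being closed. Hence \<open>ker ST\<close> is equivalent to \<open>N \<oplus> (M \<inter> N\<^sup>\<bottom>)\<close> and \<open>(Im ST)\<^sup>\<bottom>\<close> to
  \<open>M \<oplus> (N \<inter> M\<^sup>\<bottom>)\<close>. These two are equivalent because, by the polar decomposition of
  \<open>P\<^sub>M P\<^sub>N\<close>, the complement of \<open>N \<inter> M\<^sup>\<bottom>\<close> in \<open>N\<close> is equivalent to the complement of
  \<open>M \<inter> N\<^sup>\<bottom>\<close> in \<open>M\<close>.
\<close>

section \<open>Projections and adjoints\<close>

subclass (in chilbert_space) banach ..

lemma cinner_scaleC_right: "cinner x (c *\<^sub>C y) = cnj c * cinner (x::'a::chilbert_space) y"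
  by (metis cinner_commute cinner_scaleC_left complex_cnj_mult complex_cnj_cnj)

lemma bounded_linear_scaleC: "bounded_linear (\<lambda>x::'a::chilbert_space. c *\<^sub>C x)"
  and norm_scaleC: "norm (c *\<^sub>C (x::'a)) = cmod c * norm x"
proof -
  have n: "norm (c *\<^sub>C (x::'a)) = cmod c * norm x" for x
  proof -
    have "cinner (c *\<^sub>C x) (c *\<^sub>C x) = complex_of_real ((cmod c)\<^sup>2) * cinner x x"
      by (simp only: cinner_scaleC_left cinner_scaleC_right complex_norm_square mult_ac)
    then have "(norm (c *\<^sub>C x))\<^sup>2 = (cmod c * norm x)\<^sup>2"
      by (simp add: power2_norm_eq_inner inner_eq_Re_cinner power_mult_distrib)
    then show ?thesis
      by (simp add: power2_eq_iff_nonneg)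
  qed
  show "norm (c *\<^sub>C (x::'a)) = cmod c * norm x"
    by (rule n)
  show "bounded_linear (\<lambda>x::'a. c *\<^sub>C x)"
    by (rule bounded_linear_intro[where K = "cmod c"])
      (simp_all add: scaleC_add_right scaleR_scaleC scaleC_scaleC mult.commute n)
qed

lemma cinner_add_right: "cinner x (y + z) = cinner x y + cinner (x::'a::chilbert_space) z"
  by (metis cinner_commute cinner_add_left complex_cnj_add)

text \<open>Multiplying \<open>x\<close> by the unimodular phase \<open>c\<close> replaces
  \<open>cinner x y\<close> by its modulus, a real number, so the real Cauchy-Schwarz inequality for
  \<open>inner\<close> applies.\<close>

lemma cinner_Cauchy_Schwarz: "cmod (cinner x y) \<le> norm x * norm (y::'a::chilbert_space)"
proof (cases "cinner x y = 0")
  case False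
  define c where "c = cnj (sgn (cinner x y))"
  have "cmod c = 1"
    using False by (simp add: c_def norm_sgn)
  have "c * cinner x y = complex_of_real (cmod (cinner x y))"
    using False by (simp add: c_def sgn_eq mult.commute complex_norm_square[symmetric] power2_eq_square)
  then have "cmod (cinner x y) = inner (c *\<^sub>C x) y"
    by (simp add: inner_eq_Re_cinner cinner_scaleC_left)
  also have "\<dots> \<le> norm (c *\<^sub>C x) * norm y"
    by (rule norm_cauchy_schwarz)
  finally show ?thesis
    using \<open>cmod c = 1\<close> by (simp add: norm_scaleC)
qed simp

interpretation cinner: bounded_bilinear "cinner :: 'a::chilbert_space \<Rightarrow> 'a \<Rightarrow> complex"
proof
  fix r :: real and x y z :: 'a
  show "cinner (x + y) z = cinner x z + cinner y z" "cinner x (y + z) = cinner x y + cinner x z"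
    by (rule cinner_add_left cinner_add_right)+
  show "cinner (r *\<^sub>R x) y = r *\<^sub>R cinner x y" "cinner x (r *\<^sub>R y) = r *\<^sub>R cinner x y"
    by (simp_all add: scaleR_scaleC[where 'a = 'a] cinner_scaleC_left cinner_scaleC_right
        scaleR_conv_of_real)
  show "\<exists>K. \<forall>a b::'a. cmod (cinner a b) \<le> norm a * norm b * K"
    by (rule exI[of _ 1]) (simp add: cinner_Cauchy_Schwarz)
qed

lemma scaleC_zero_right [simp]: "c *\<^sub>C (0::'a::chilbert_space) = 0"
  using bounded_linear_scaleC by (rule linear_simps)

declare cinner.zero_left [simp] cinner.zero_right [simp]

lemmas cinner_simps = cinner.add_left cinner.add_right cinner.diff_left cinner.diff_right
  cinner.minus_left cinner.minus_right cinner_scaleC_left cinner_scaleC_right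

lemma cinner_eq_zero_sym: "cinner x y = 0 \<longleftrightarrow> cinner y (x::'a::chilbert_space) = 0"
  by (metis cinner_commute complex_cnj_zero)

lemma cinner_self: "cinner x x = complex_of_real ((norm (x::'a::chilbert_space))\<^sup>2)"
proof (rule complex_eqI)
  show "Re (cinner x x) = Re (complex_of_real ((norm x)\<^sup>2))"
    by (simp only: Re_complex_of_real power2_norm_eq_inner inner_eq_Re_cinner)
  have "Im (cinner x x) = Im (cnj (cinner x x))"
    using cinner_commute by metis
  then show "Im (cinner x x) = Im (complex_of_real ((norm x)\<^sup>2))"
    by simp
qed

lemma cinner_self_eq_zero: "cinner x x = 0 \<longleftrightarrow> (x::'a::chilbert_space) = 0"
  by (simp add: cinner_self)

text \<open>Since the second slot is conjugate-linear, replacing \<open>y\<close> by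
  \<open>\<i> *\<^sub>C y\<close> moves the imaginary part into the real one. This upgrades real
  orthogonality to complex orthogonality.\<close>

lemma cinner_eq_via_inner:
  "cinner x y = Complex (inner x y) (inner x (\<i> *\<^sub>C (y::'a::chilbert_space)))"
  by (rule complex_eqI) (simp_all add: inner_eq_Re_cinner cinner_scaleC_right)

lemma cinner_ext_right:
  assumes "\<And>x. cinner x y = cinner x (z::'a::chilbert_space)"
  shows "y = z"
proof -
  have "cinner (y - z) (y - z) = 0"
    by (metis assms cinner.diff_right diff_self)
  then show ?thesis
    by (simp add: cinner_self_eq_zero)
qed

lemma cinner_ext_left:
  assumes "\<And>x. cinner y x = cinner (z::'a::chilbert_space) x"
  shows "y = z"
  by (rule cinner_ext_right) (metis assms cinner_commute)

section \<open>Bounded complex-linear operators and closed subspaces\<close>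

lemma bounded_clinear_add: "bounded_clinear T \<Longrightarrow> T (x + y) = T x + T y"
  and bounded_clinear_diff: "bounded_clinear T \<Longrightarrow> T (x - y) = T x - T y"
  and bounded_clinear_zero: "bounded_clinear T \<Longrightarrow> T 0 = 0"
  and bounded_clinear_scaleC: "bounded_clinear T \<Longrightarrow> T (c *\<^sub>C x) = c *\<^sub>C T x"
  and bounded_clinear_bounded_linear: "bounded_clinear T \<Longrightarrow> bounded_linear T"
  by (auto simp: bounded_clinear_def linear_simps)

lemma bounded_clinear_compose:
  "bounded_clinear S \<Longrightarrow> bounded_clinear T \<Longrightarrow> bounded_clinear (S \<circ> T)"
  unfolding bounded_clinear_def comp_def by (auto intro: bounded_linear_compose)

lemma bounded_clinearI:
  assumes "\<And>x y. T (x + y) = T x + T y" "\<And>c x. T (c *\<^sub>C x) = c *\<^sub>C T x"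
    and "\<And>x. norm (T x) \<le> K * norm x"
  shows "bounded_clinear T"
  unfolding bounded_clinear_def using assms
  by (auto intro!: bounded_linear_intro[where K = K] simp: scaleR_scaleC mult.commute)

lemma closed_csubspace_zero: "closed_csubspace L \<Longrightarrow> 0 \<in> L"
  and closed_csubspace_add: "closed_csubspace L \<Longrightarrow> x \<in> L \<Longrightarrow> y \<in> L \<Longrightarrow> x + y \<in> L"
  and closed_csubspace_scaleC: "closed_csubspace L \<Longrightarrow> x \<in> L \<Longrightarrow> c *\<^sub>C x \<in> L"
  and closed_csubspace_closed: "closed_csubspace L \<Longrightarrow> closed L"
  by (auto simp: closed_csubspace_def)

lemma closed_csubspace_scaleR: "closed_csubspace L \<Longrightarrow> x \<in> L \<Longrightarrow> r *\<^sub>R x \<in> L"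
  by (simp add: scaleR_scaleC closed_csubspace_scaleC)

lemma closed_csubspace_diff: "closed_csubspace L \<Longrightarrow> x \<in> L \<Longrightarrow> y \<in> L \<Longrightarrow> x - y \<in> L"
  using closed_csubspace_add[of L x "(-1) *\<^sub>R y"] closed_csubspace_scaleR[of L y "-1"] by simp

lemma closed_csubspace_Int:
  "closed_csubspace K \<Longrightarrow> closed_csubspace L \<Longrightarrow> closed_csubspace (K \<inter> L)"
  by (auto simp: closed_csubspace_def)

lemma closed_csubspace_ker:
  assumes "bounded_clinear T"
  shows "closed_csubspace (ker T)"
proof -
  have "closed (T -` {0})"
    by (intro continuous_closed_vimage closed_singleton linear_continuous_at
        bounded_clinear_bounded_linear assms)
  then show ?thesis
    using assms
    by (auto simp: closed_csubspace_def ker_def vimage_def bounded_clinear_add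
        bounded_clinear_zero bounded_clinear_scaleC)
qed

lemma closed_csubspace_range:
  assumes "bounded_clinear T" "closed (range T)"
  shows "closed_csubspace (range T)"
  using assms unfolding closed_csubspace_def
  by (auto simp: image_iff) (metis bounded_clinear_zero bounded_clinear_add bounded_clinear_scaleC)+

lemma closed_csubspace_orth_compl: "closed_csubspace (orth_compl (X::'a::chilbert_space set))"
proof -
  have "orth_compl X = (\<Inter>y\<in>X. (\<lambda>x. cinner x y) -` {0})"
    by (auto simp: orth_compl_def)
  moreover have "closed ((\<lambda>x. cinner x y) -` {0})" for y :: 'a
    by (intro continuous_closed_vimage closed_singleton linear_continuous_at
        cinner.bounded_linear_left)
  ultimately have "closed (orth_compl X)"
    by auto
  then show ?thesis
    by (auto simp: closed_csubspace_def orth_compl_def cinner_simps)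
qed

section \<open>Orthogonal projection onto a closed subspace\<close>

lemma parallelogram_minimizer_bound:
  fixes x y z :: "'a::real_inner"
  assumes "d \<le> norm (x - (1/2) *\<^sub>R (y + z))" "0 \<le> d"
  shows "(norm (y - z))\<^sup>2 \<le> 2 * (norm (x - y))\<^sup>2 + 2 * (norm (x - z))\<^sup>2 - 4 * d\<^sup>2"
proof -
  \<comment> \<open>The parallelogram law for \<open>x - y\<close> and \<open>x - z\<close>, whose
    sum is twice the vector from the midpoint of \<open>y\<close> and \<open>z\<close> to
    \<open>x\<close>.\<close>
  have "(norm (y - z))\<^sup>2 = 2 * (norm (x - y))\<^sup>2 + 2 * (norm (x - z))\<^sup>2
      - 4 * (norm (x - (1/2) *\<^sub>R (y + z)))\<^sup>2"
    by (simp add: power2_norm_eq_inner inner_simps inner_commute algebra_simps)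
  moreover have "d\<^sup>2 \<le> (norm (x - (1/2) *\<^sub>R (y + z)))\<^sup>2"
    using assms by (intro power_mono)
  ultimately show ?thesis
    by simp
qed

text \<open>A point of \<open>L\<close> nearest to \<open>x\<close> exists by completeness, and
  minimality forces the remainder to be orthogonal to \<open>L\<close>.\<close>

lemma orthogonal_decomposition_exists:
  fixes L :: "'a::chilbert_space set"
  assumes L: "closed_csubspace L"
  shows "\<exists>y. y \<in> L \<and> x - y \<in> orth_compl L"
proof -
  have ne: "L \<noteq> {}"
    using closed_csubspace_zero[OF L] by auto
  define d where "d = infdist x L"
  have dle: "d \<le> norm (x - y)" if "y \<in> L" for y
    using that by (auto simp: d_def dist_norm[symmetric] intro: infdist_le)
  have d0: "0 \<le> d"
    by (simp add: d_def infdist_nonneg)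
  have "\<exists>y\<in>L. norm (x - y) < d + inverse (real (Suc n))" for n
  proof -
    have "(INF y\<in>L. dist x y) < d + inverse (real (Suc n))"
      using ne by (simp add: d_def infdist_def)
    then show ?thesis
      using cInf_lessD[of "dist x ` L"] ne by (auto simp: dist_norm)
  qed
  then obtain y where yL: "\<And>n. y n \<in> L"
    and y: "\<And>n. norm (x - y n) < d + inverse (real (Suc n))"
    by metis
  have lim: "(\<lambda>n. norm (x - y n)) \<longlonglongrightarrow> d"
  proof (rule tendsto_sandwich[where f = "\<lambda>_. d"])
    show "(\<lambda>n. d + inverse (real (Suc n))) \<longlonglongrightarrow> d"
      using tendsto_add[OF tendsto_const LIMSEQ_inverse_real_of_nat] by fastforce
    show "\<forall>\<^sub>F n in sequentially. norm (x - y n) \<le> d + inverse (real (Suc n))"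
      using y by (intro always_eventually allI less_imp_le)
  qed (use dle yL in auto)
  \<comment> \<open>The midpoint of \<open>y m\<close> and \<open>y n\<close> is again in
    \<open>L\<close>, hence at distance at least \<open>d\<close> from \<open>x\<close>; this makes
    the minimizing sequence Cauchy.\<close>
  have par: "(norm (y m - y n))\<^sup>2 \<le> 2 * (norm (x - y m))\<^sup>2 + 2 * (norm (x - y n))\<^sup>2 - 4 * d\<^sup>2"
    for m n
    by (intro parallelogram_minimizer_bound dle d0 closed_csubspace_scaleR closed_csubspace_add L yL)
  have "Cauchy y"
  proof (rule CauchyI)
    fix e :: real
    assume e: "0 < e"
    have "(\<lambda>n. (norm (x - y n))\<^sup>2) \<longlonglongrightarrow> d\<^sup>2"
      by (intro tendsto_power lim)
    then have "\<forall>\<^sub>F n in sequentially. (norm (x - y n))\<^sup>2 < d\<^sup>2 + e\<^sup>2 / 4"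
      using e by (intro order_tendstoD(2)) auto
    then obtain N where N: "\<And>n. n \<ge> N \<Longrightarrow> (norm (x - y n))\<^sup>2 < d\<^sup>2 + e\<^sup>2 / 4"
      by (auto simp: eventually_sequentially)
    have "norm (y m - y n) < e" if "m \<ge> N" "n \<ge> N" for m n
    proof (rule power_less_imp_less_base)
      show "(norm (y m - y n))\<^sup>2 < e\<^sup>2"
        using par[of m n] N[OF that(1)] N[OF that(2)] by simp
    qed (use e in simp)
    then show "\<exists>M. \<forall>m\<ge>M. \<forall>n\<ge>M. norm (y m - y n) < e"
      by blast
  qed
  then obtain l where l: "y \<longlonglongrightarrow> l"
    using Cauchy_convergent_iff convergent_def by blast
  have lL: "l \<in> L"
    using closed_sequentially[OF closed_csubspace_closed[OF L]] yL l by blast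
  have "(\<lambda>n. norm (x - y n)) \<longlonglongrightarrow> norm (x - l)"
    by (intro tendsto_intros l)
  then have nl: "norm (x - l) = d"
    using lim LIMSEQ_unique by blast
  have orth: "inner (x - l) z = 0" if z: "z \<in> L" for z
  proof (cases "z = 0")
    case False
    \<comment> \<open>This value minimizes the distance from \<open>x - l\<close> to the real line
      spanned by \<open>z\<close>; comparison with the minimality of \<open>l\<close> leaves only a
      zero inner product.\<close>
    define t where "t = inner (x - l) z / (norm z)\<^sup>2"
    have "norm (x - l) \<le> norm (x - (l + t *\<^sub>R z))"
      unfolding nl by (intro dle closed_csubspace_add closed_csubspace_scaleR L lL z)
    then have "(norm (x - l))\<^sup>2 \<le> (norm ((x - l) - t *\<^sub>R z))\<^sup>2"
      by (simp add: diff_diff_eq)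
    also have "\<dots> = (norm (x - l))\<^sup>2 - 2 * t * inner (x - l) z + t\<^sup>2 * (norm z)\<^sup>2"
      unfolding power2_norm_eq_inner
      by (simp add: inner_simps inner_commute algebra_simps power2_eq_square)
    also have "\<dots> = (norm (x - l))\<^sup>2 - (inner (x - l) z)\<^sup>2 / (norm z)\<^sup>2"
      using False by (simp add: t_def field_simps power2_eq_square)
    finally have "(inner (x - l) z)\<^sup>2 / (norm z)\<^sup>2 \<le> 0"
      by simp
    then show ?thesis
      using False by (simp add: divide_le_0_iff)
  qed simp
  \<comment> \<open>\<open>L\<close> contains \<open>\<i> *\<^sub>C z\<close> along with
    \<open>z\<close>, so the real and the imaginary part both vanish.\<close>
  then have "cinner (x - l) z = 0" if "z \<in> L" for z
    unfolding cinner_eq_via_inner using that closed_csubspace_scaleC[OF L that]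
    by (simp add: complex_eq_iff)
  then show ?thesis
    using lL by (auto simp: orth_compl_def)
qed

lemma Proj_unique:
  assumes L: "closed_csubspace L" and y: "y \<in> L" "x - y \<in> orth_compl L"
    and z: "z \<in> L" "x - z \<in> orth_compl L"
  shows "y = z"
proof -
  have "y - z \<in> L"
    by (intro closed_csubspace_diff L y z)
  moreover have "(x - z) - (x - y) \<in> orth_compl L"
    by (intro closed_csubspace_diff closed_csubspace_orth_compl y z)
  ultimately have "cinner (y - z) (y - z) = 0"
    by (simp add: orth_compl_def)
  then show ?thesis
    by (simp add: cinner_self_eq_zero)
qed

lemma Proj_eqI:
  assumes "closed_csubspace L" "y \<in> L" "x - y \<in> orth_compl L"
  shows "Proj L x = y"
  unfolding Proj_def using assms Proj_unique by (intro the_equality) blast+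

lemma
  assumes "closed_csubspace L"
  shows Proj_in: "Proj L x \<in> L" and Proj_diff_in: "x - Proj L x \<in> orth_compl L"
  using orthogonal_decomposition_exists[OF assms, of x] Proj_eqI[OF assms, of _ x] by auto

lemma orth_complD: "x \<in> orth_compl L \<Longrightarrow> y \<in> L \<Longrightarrow> cinner x y = 0"
  "x \<in> orth_compl L \<Longrightarrow> y \<in> L \<Longrightarrow> cinner y x = 0"
  by (auto simp: orth_compl_def cinner_eq_zero_sym)

lemma orth_complI: "(\<And>y. y \<in> L \<Longrightarrow> cinner x y = 0) \<Longrightarrow> x \<in> orth_compl L"
  by (auto simp: orth_compl_def)

lemma orth_compl_antimono: "K \<subseteq> L \<Longrightarrow> orth_compl L \<subseteq> orth_compl K"
  by (auto simp: orth_compl_def)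

lemma subset_orth_compl_orth_compl: "L \<subseteq> orth_compl (orth_compl L)"
  by (auto simp: orth_compl_def cinner_eq_zero_sym)

lemma Int_orth_compl: "x \<in> L \<Longrightarrow> x \<in> orth_compl L \<Longrightarrow> x = 0"
  using orth_complD cinner_self_eq_zero by blast

lemma Proj_fixes: "closed_csubspace L \<Longrightarrow> x \<in> L \<Longrightarrow> Proj L x = x"
  by (rule Proj_eqI) (auto simp: closed_csubspace_zero closed_csubspace_orth_compl)

lemma Proj_orth_eq_zero: "closed_csubspace L \<Longrightarrow> x \<in> orth_compl L \<Longrightarrow> Proj L x = 0"
  by (rule Proj_eqI) (auto simp: closed_csubspace_zero)

lemma orth_compl_orth_compl:
  assumes "closed_csubspace L"
  shows "orth_compl (orth_compl L) = L"
proof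
  show "orth_compl (orth_compl L) \<subseteq> L"
  proof
    fix x assume x: "x \<in> orth_compl (orth_compl L)"
    have "x - Proj L x \<in> orth_compl (orth_compl L)"
      using x Proj_in[OF assms, of x] subset_orth_compl_orth_compl[of L]
      by (intro closed_csubspace_diff closed_csubspace_orth_compl) auto
    then have "x - Proj L x = 0"
      using Int_orth_compl[OF Proj_diff_in[OF assms]] by blast
    then show "x \<in> L"
      using Proj_in[OF assms, of x] by simp
  qed
qed (rule subset_orth_compl_orth_compl)

lemma cinner_Proj_left:
  assumes "closed_csubspace L"
  shows "cinner (Proj L x) y = cinner (Proj L x) (Proj L y)"
  using orth_complD(2)[OF Proj_diff_in[OF assms, of y] Proj_in[OF assms, of x]]
  by (simp add: cinner_simps)

lemma cinner_Proj_swap: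
  assumes "closed_csubspace L"
  shows "cinner (Proj L x) y = cinner x (Proj L y)"
  using cinner_Proj_left[OF assms, of x y] cinner_Proj_left[OF assms, of y x]
    cinner_commute[of x "Proj L y"] cinner_commute[of "Proj L x" "Proj L y"] by simp

lemma norm_Proj_Pythagoras:
  assumes "closed_csubspace L"
  shows "(norm x)\<^sup>2 = (norm (Proj L x))\<^sup>2 + (norm (x - Proj L x))\<^sup>2"
proof -
  have "cinner (Proj L x) (x - Proj L x) = 0"
    using orth_complD(2)[OF Proj_diff_in[OF assms] Proj_in[OF assms]] .
  then have "inner (Proj L x) (x - Proj L x) = 0"
    by (simp add: inner_eq_Re_cinner)
  then show ?thesis
    by (simp add: power2_norm_eq_inner inner_simps inner_commute)
qed

lemma norm_Proj_le: "closed_csubspace L \<Longrightarrow> norm (Proj L x) \<le> norm x"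
  by (rule power2_le_imp_le) (use norm_Proj_Pythagoras[of L x] in auto)

text \<open>\<open>Proj L\<close> moves across the inner product by \<open>cinner_Proj_swap\<close>,
  so its linearity follows from that of the inner product, tested against every vector.\<close>

lemma bounded_clinear_Proj:
  assumes "closed_csubspace L"
  shows "bounded_clinear (Proj L)"
proof (rule bounded_clinearI[where K = 1])
  fix x y :: 'a and c
  show "Proj L (x + y) = Proj L x + Proj L y"
    by (rule cinner_ext_left) (simp add: cinner_Proj_swap[OF assms] cinner_simps)
  show "Proj L (c *\<^sub>C x) = c *\<^sub>C Proj L x"
    by (rule cinner_ext_left) (simp add: cinner_Proj_swap[OF assms] cinner_simps)
qed (simp add: norm_Proj_le assms)

section \<open>Riesz representation and adjoints\<close>

lemma Riesz_representation:
  fixes f :: "'a::chilbert_space \<Rightarrow> complex"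
  assumes bl: "bounded_linear f" and sc: "\<And>c x. f (c *\<^sub>C x) = c * f x"
  shows "\<exists>y. \<forall>x. f x = cinner x y"
proof (cases "\<forall>x. f x = 0")
  case True
  then show ?thesis
    by (intro exI[of _ 0]) simp
next
  case False
  then obtain a where a: "f a \<noteq> 0"
    by blast
  interpret bounded_linear f by (rule bl)
  define L where "L = f -` {0}"
  have "closed L"
    unfolding L_def by (intro continuous_closed_vimage closed_singleton linear_continuous_at bl)
  then have L: "closed_csubspace L"
    by (auto simp: closed_csubspace_def L_def zero add sc)
  \<comment> \<open>The component of \<open>a\<close> orthogonal to the kernel of \<open>f\<close>.
    Every \<open>x\<close> differs from a multiple of \<open>e\<close> by an element of that kernel,
    so a rescaled \<open>e\<close> represents \<open>f\<close>.\<close>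
  define e where "e = a - Proj L a"
  have fe: "f e = f a"
    using Proj_in[OF L, of a] by (simp add: e_def diff L_def)
  have e: "e \<in> orth_compl L"
    unfolding e_def by (rule Proj_diff_in[OF L])
  have "e \<noteq> 0"
    using fe a zero by auto
  then have ee: "cinner e e \<noteq> 0"
    by (simp add: cinner_self_eq_zero)
  have "f x = cinner x (cnj (f e / cinner e e) *\<^sub>C e)" for x
  proof -
    have "x - (f x / f e) *\<^sub>C e \<in> L"
      using a fe by (simp add: L_def diff sc)
    then have "cinner (x - (f x / f e) *\<^sub>C e) e = 0"
      by (rule orth_complD(2)[OF e])
    then have "cinner x e = f x / f e * cinner e e"
      by (simp add: cinner_simps)
    then show ?thesis
      using ee a fe by (simp add: cinner_simps)
  qed
  then show ?thesis
    by blast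
qed

lemma adj_eqI:
  assumes "\<And>x y. cinner (T x) y = cinner x (R y)"
  shows "adj T = R"
  unfolding adj_def
proof (rule the_equality)
  fix R' assume "\<forall>x y. cinner (T x) y = cinner x (R' y)"
  then have "cinner x (R' y) = cinner x (R y)" for x y
    using assms[of x y] by simp
  then show "R' = R"
    by (intro ext) (rule cinner_ext_right)
qed (simp add: assms)

text \<open>Riesz representation supplies, for each \<open>y\<close>, the value an adjoint must take
  there; by \<open>adj_eqI\<close> the function so obtained is the one described by
  \<open>adj\<close>.\<close>

lemma cinner_adj:
  assumes T: "bounded_clinear T"
  shows "cinner (T x) y = cinner x (adj T y)"
proof -
  have "\<exists>z. \<forall>x. cinner (T x) y = cinner x z" for y
  proof (rule Riesz_representation)
    show "bounded_linear (\<lambda>x. cinner (T x) y)"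
      using bounded_linear_compose[OF cinner.bounded_linear_left
          bounded_clinear_bounded_linear[OF T]] .
  qed (simp add: bounded_clinear_scaleC[OF T] cinner_simps)
  then obtain R where R: "\<And>x y. cinner (T x) y = cinner x (R y)"
    by metis
  then have "adj T = R"
    by (rule adj_eqI)
  then show ?thesis
    by (simp add: R)
qed

lemma cinner_adj': "bounded_clinear T \<Longrightarrow> cinner (adj T x) y = cinner x (T y)"
  by (subst (1 2) cinner_commute) (simp only: cinner_adj)

text \<open>The square of \<open>norm (adj T x)\<close> is the modulus of
  \<open>cinner x (T (adj T x))\<close>; Cauchy-Schwarz bounds it, and one factor
  \<open>norm (adj T x)\<close> cancels.\<close>

lemma norm_adj_le:
  assumes T: "bounded_clinear T" and K: "\<And>x. norm (T x) \<le> K * norm x"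
  shows "norm (adj T x) \<le> K * norm x"
proof (cases "adj T x = 0")
  case True
  then show ?thesis
    using order_trans[OF norm_ge_zero K] by simp
next
  case False
  have "(norm (adj T x))\<^sup>2 = cmod (cinner (adj T x) (adj T x))"
    by (simp add: cinner_self norm_power)
  also have "\<dots> = cmod (cinner x (T (adj T x)))"
    by (simp add: cinner_adj'[OF T])
  also have "\<dots> \<le> norm x * (K * norm (adj T x))"
    by (rule order_trans[OF cinner_Cauchy_Schwarz mult_left_mono[OF K norm_ge_zero]])
  finally have "norm (adj T x) * norm (adj T x) \<le> (K * norm x) * norm (adj T x)"
    by (simp add: power2_eq_square mult_ac)
  then show ?thesis
    using False by simp
qed

lemma bounded_clinear_pos_bounded:
  assumes "bounded_clinear T"
  obtains K where "K > 0" "\<And>x. norm (T x) \<le> K * norm x"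
  using bounded_linear.pos_bounded[OF bounded_clinear_bounded_linear[OF assms]]
  by (metis mult.commute)

lemma bounded_clinear_adj:
  assumes T: "bounded_clinear T"
  shows "bounded_clinear (adj T)"
proof -
  obtain K where "\<And>x. norm (T x) \<le> K * norm x"
    using bounded_clinear_pos_bounded[OF T] by blast
  note K = norm_adj_le[OF T this]
  show ?thesis
  proof (rule bounded_clinearI[OF _ _ K])
    fix x y :: 'a and c
    show "adj T (x + y) = adj T x + adj T y"
      by (rule cinner_ext_left) (simp add: cinner_adj'[OF T] cinner_simps)
    show "adj T (c *\<^sub>C x) = c *\<^sub>C adj T x"
      by (rule cinner_ext_left) (simp add: cinner_adj'[OF T] cinner_simps)
  qed
qed

lemma adj_adj: "bounded_clinear T \<Longrightarrow> adj (adj T) = T"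
  by (rule adj_eqI) (simp add: cinner_adj')

lemma adj_compose: "bounded_clinear S \<Longrightarrow> bounded_clinear T \<Longrightarrow> adj (S \<circ> T) = adj T \<circ> adj S"
  by (rule adj_eqI) (simp add: cinner_adj)

lemma adj_Proj: "closed_csubspace L \<Longrightarrow> adj (Proj L) = Proj L"
  by (rule adj_eqI) (rule cinner_Proj_swap)

lemma is_projection_Proj: "closed_csubspace L \<Longrightarrow> is_projection (Proj L)"
  by (auto simp: is_projection_def bounded_clinear_Proj adj_Proj Proj_fixes Proj_in)

text \<open>As \<open>K \<subseteq> L\<close>, \<open>Proj K\<close> factors through
  \<open>Proj L\<close>, so its values are no larger in norm; the quadratic form of a projection is
  the squared norm of the projected vector.\<close>

lemma op_le_Proj:
  assumes K: "closed_csubspace K" and L: "closed_csubspace L" and "K \<subseteq> L"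
  shows "op_le (Proj K) (Proj L)"
proof -
  have "Proj K x = Proj K (Proj L x)" for x
  proof -
    have "x - Proj L x \<in> orth_compl K"
      using Proj_diff_in[OF L] orth_compl_antimono[OF \<open>K \<subseteq> L\<close>] by blast
    then have "Proj K (x - Proj L x) = 0"
      by (rule Proj_orth_eq_zero[OF K])
    then show ?thesis
      by (simp add: bounded_clinear_diff[OF bounded_clinear_Proj[OF K]])
  qed
  then have "norm (Proj K x) \<le> norm (Proj L x)" for x
    using norm_Proj_le[OF K] by metis
  moreover have "cinner (Proj L x - Proj K x) x
      = complex_of_real ((norm (Proj L x))\<^sup>2 - (norm (Proj K x))\<^sup>2)" for x
    by (simp add: cinner_simps cinner_Proj_left[OF K, of x x] cinner_Proj_left[OF L, of x x]
        cinner_self)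
  ultimately show ?thesis
    by (simp add: op_le_def)
qed

lemma orth_compl_range: "bounded_clinear T \<Longrightarrow> orth_compl (range T) = ker (adj T)"
proof -
  assume T: "bounded_clinear T"
  have "(\<forall>y. cinner x (T y) = 0) \<longleftrightarrow> adj T x = 0" for x
  proof
    assume "\<forall>y. cinner x (T y) = 0"
    then have "cinner (adj T x) (adj T x) = 0"
      by (simp add: cinner_adj'[OF T])
    then show "adj T x = 0"
      by (simp add: cinner_self_eq_zero)
  qed (simp add: cinner_adj'[OF T, symmetric])
  then show ?thesis
    by (auto simp: orth_compl_def ker_def)
qed

section \<open>Square roots\<close>

text \<open>
  If \<open>Z\<close> is the limit of this iteration then \<open>2 Z = X + Z\<^sup>2\<close>, i.e. \<open>(1 - Z)\<^sup>2 = 1 - X\<close>. For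
  \<open>norm X \<le> 1\<close> its increments are dominated by those of the scalar iteration with \<open>X = 1\<close>, which
  increases to 1.
\<close>

primrec sqrt_iter :: "('a::real_normed_vector \<Rightarrow>\<^sub>L 'a) \<Rightarrow> nat \<Rightarrow> ('a \<Rightarrow>\<^sub>L 'a)"
  where
    "sqrt_iter X 0 = 0"
  | "sqrt_iter X (Suc n) = (1/2) *\<^sub>R (X + (sqrt_iter X n o\<^sub>L sqrt_iter X n))"

primrec sqrt_majorant :: "nat \<Rightarrow> real"
  where
    "sqrt_majorant 0 = 0"
  | "sqrt_majorant (Suc n) = (1 + (sqrt_majorant n)\<^sup>2) / 2"

lemma sqrt_majorant_bounds: "0 \<le> sqrt_majorant n \<and> sqrt_majorant n \<le> 1"
proof (induction n)
  case (Suc n)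
  then have "(sqrt_majorant n)\<^sup>2 \<le> 1"
    by (simp add: power_le_one)
  then show ?case
    by simp
qed simp

lemma incseq_sqrt_majorant: "incseq sqrt_majorant"
proof (rule incseq_SucI)
  fix n
  have "sqrt_majorant (Suc n) - sqrt_majorant n = (1 - sqrt_majorant n)\<^sup>2 / 2"
    by (simp add: power2_eq_square field_simps)
  then show "sqrt_majorant n \<le> sqrt_majorant (Suc n)"
    by (smt (verit) zero_le_power2 divide_nonneg_nonneg)
qed

lemma Cauchy_sqrt_majorant: "Cauchy sqrt_majorant"
proof -
  have "convergent sqrt_majorant"
    by (rule Bseq_mono_convergent)
      (use sqrt_majorant_bounds incseq_sqrt_majorant in \<open>auto simp: incseq_def intro!: BseqI'[of _ 1]\<close>)
  then show ?thesis
    by (rule convergent_Cauchy)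
qed

lemma norm_sqrt_iter_le:
  assumes "norm X \<le> 1"
  shows "norm (sqrt_iter X n) \<le> sqrt_majorant n"
proof (induction n)
  case (Suc n)
  have "norm (X + (sqrt_iter X n o\<^sub>L sqrt_iter X n)) \<le> norm X + norm (sqrt_iter X n) * norm (sqrt_iter X n)"
    by (intro order_trans[OF norm_triangle_ineq] add_left_mono norm_blinfun_compose)
  also have "\<dots> \<le> 1 + sqrt_majorant n * sqrt_majorant n"
    using assms Suc by (intro add_mono mult_mono) (auto intro: order_trans[OF norm_ge_zero])
  finally show ?case
    by (simp add: power2_eq_square)
qed simp

lemma norm_sqrt_iter_diff_le:
  assumes X: "norm X \<le> 1"
  shows "norm (sqrt_iter X (Suc n) - sqrt_iter X n) \<le> sqrt_majorant (Suc n) - sqrt_majorant n"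
proof (induction n)
  case 0
  then show ?case
    using X by simp
next
  case (Suc n)
  let ?Y = "sqrt_iter X" and ?y = sqrt_majorant
  \<comment> \<open>A difference of two squares, split in a way valid for noncommuting factors. The
    scalar iteration satisfies the same identity exactly, which carries the domination through the
    induction.\<close>
  have "?Y (Suc (Suc n)) - ?Y (Suc n)
      = (1/2) *\<^sub>R ((?Y (Suc n) o\<^sub>L (?Y (Suc n) - ?Y n)) + ((?Y (Suc n) - ?Y n) o\<^sub>L ?Y n))"
    by (simp only: sqrt_iter.simps(2)[of X "Suc n"] sqrt_iter.simps(2)[of X n, symmetric]
        bounded_bilinear.diff_left[OF bounded_bilinear_blinfun_compose]
        bounded_bilinear.diff_right[OF bounded_bilinear_blinfun_compose])
      (simp add: algebra_simps)
  also have "norm \<dots> \<le> (1/2) * (norm (?Y (Suc n)) * norm (?Y (Suc n) - ?Y n)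
      + norm (?Y (Suc n) - ?Y n) * norm (?Y n))"
    by (simp del: sqrt_iter.simps)
      (intro order_trans[OF norm_triangle_ineq] add_mono norm_blinfun_compose)
  also have "\<dots> \<le> (1/2) * (?y (Suc n) * (?y (Suc n) - ?y n) + (?y (Suc n) - ?y n) * ?y n)"
    using Suc norm_sqrt_iter_le[OF X, of n] norm_sqrt_iter_le[OF X, of "Suc n"]
      sqrt_majorant_bounds[of n] sqrt_majorant_bounds[of "Suc n"]
      incseq_SucD[OF incseq_sqrt_majorant, of n]
    by (intro mult_left_mono add_mono mult_mono) (auto simp del: sqrt_iter.simps sqrt_majorant.simps)
  also have "\<dots> = ?y (Suc (Suc n)) - ?y (Suc n)"
    by (simp only: sqrt_majorant.simps(2)[of "Suc n"]) (simp add: power2_eq_square field_simps)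
  finally show ?case .
qed

lemma norm_sqrt_iter_diff_le':
  assumes X: "norm X \<le> 1" and "m \<le> n"
  shows "norm (sqrt_iter X n - sqrt_iter X m) \<le> sqrt_majorant n - sqrt_majorant m"
  using \<open>m \<le> n\<close>
proof (induction n rule: dec_induct)
  case (step n)
  have "norm (sqrt_iter X (Suc n) - sqrt_iter X m)
      \<le> norm (sqrt_iter X (Suc n) - sqrt_iter X n) + norm (sqrt_iter X n - sqrt_iter X m)"
    by (rule norm_diff_triangle_ineq[of _ "sqrt_iter X n" "sqrt_iter X n", simplified])
  then show ?case
    using step.IH norm_sqrt_iter_diff_le[OF X, of n] by linarith
qed simp

lemma sqrt_iter_converges:
  fixes X :: "'a::banach \<Rightarrow>\<^sub>L 'a"
  assumes X: "norm X \<le> 1"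
  obtains Z where "sqrt_iter X \<longlonglongrightarrow> Z" "2 *\<^sub>R Z = X + (Z o\<^sub>L Z)"
proof -
  have "Cauchy (sqrt_iter X)"
  proof (rule metric_CauchyI)
    fix e :: real
    assume "0 < e"
    then obtain M where M: "\<And>m n. m \<ge> M \<Longrightarrow> n \<ge> M \<Longrightarrow> dist (sqrt_majorant m) (sqrt_majorant n) < e"
      using Cauchy_sqrt_majorant unfolding Cauchy_def by blast
    have "dist (sqrt_iter X n) (sqrt_iter X m) < e" if "m \<ge> M" "n \<ge> M" "m \<le> n" for m n
      using M[OF that(2,1)] norm_sqrt_iter_diff_le'[OF X that(3)]
      by (simp add: dist_norm)
    then have "dist (sqrt_iter X m) (sqrt_iter X n) < e" if "m \<ge> M" "n \<ge> M" for m n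
      using that by (metis dist_commute nle_le)
    then show "\<exists>M. \<forall>m\<ge>M. \<forall>n\<ge>M. dist (sqrt_iter X m) (sqrt_iter X n) < e"
      by blast
  qed
  then obtain Z where Z: "sqrt_iter X \<longlonglongrightarrow> Z"
    using Cauchy_convergent_iff convergent_def by blast
  have "(\<lambda>n. sqrt_iter X (Suc n)) \<longlonglongrightarrow> (1/2) *\<^sub>R (X + (Z o\<^sub>L Z))"
    unfolding sqrt_iter.simps
    by (intro tendsto_intros bounded_bilinear.tendsto[OF bounded_bilinear_blinfun_compose] Z)
  moreover have "(\<lambda>n. sqrt_iter X (Suc n)) \<longlonglongrightarrow> Z"
    using Z by (rule LIMSEQ_Suc)
  ultimately have "Z = (1/2) *\<^sub>R (X + (Z o\<^sub>L Z))"
    by (rule LIMSEQ_unique[rotated])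
  then have "2 *\<^sub>R Z = X + (Z o\<^sub>L Z)"
    by (metis scaleR_2 scaleR_half_double scaleR_add_right)
  then show thesis
    using Z that by blast
qed

text \<open>Each iterate is a polynomial in \<open>X\<close>, so it commutes with whatever commutes
  with \<open>X\<close>, and commutation survives the limit.\<close>

lemma sqrt_iter_commutes:
  assumes lim: "sqrt_iter X \<longlonglongrightarrow> Z" and C: "bounded_linear C" "\<And>x. C (blinfun_apply X x) = blinfun_apply X (C x)"
  shows "C (blinfun_apply Z x) = blinfun_apply Z (C x)"
proof -
  interpret C: bounded_linear C by fact
  have "C (blinfun_apply (sqrt_iter X n) x) = blinfun_apply (sqrt_iter X n) (C x)" for n x
    by (induction n arbitrary: x)
      (simp_all add: C C.zero C.add C.scaleR blinfun.add_left blinfun.scaleR_left)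
  moreover have "(\<lambda>n. C (blinfun_apply (sqrt_iter X n) x)) \<longlonglongrightarrow> C (blinfun_apply Z x)"
    by (intro C.tendsto blinfun.tendsto lim tendsto_const)
  moreover have "(\<lambda>n. blinfun_apply (sqrt_iter X n) (C x)) \<longlonglongrightarrow> blinfun_apply Z (C x)"
    by (intro blinfun.tendsto lim tendsto_const)
  ultimately show ?thesis
    using LIMSEQ_unique by simp
qed

text \<open>The iterates are polynomials with real coefficients in the selfadjoint \<open>X\<close>;
  continuity of the inner product passes the symmetry on to the limit.\<close>

lemma sqrt_iter_selfadjoint:
  fixes X :: "'a::chilbert_space \<Rightarrow>\<^sub>L 'a"
  assumes lim: "sqrt_iter X \<longlonglongrightarrow> Z"
    and X: "\<And>x y. cinner (blinfun_apply X x) y = cinner x (blinfun_apply X y)"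
  shows "cinner (blinfun_apply Z x) y = cinner x (blinfun_apply Z y)"
proof -
  have "cinner (blinfun_apply (sqrt_iter X n) x) y = cinner x (blinfun_apply (sqrt_iter X n) y)"
    for n x y
    by (induction n arbitrary: x y)
      (simp_all add: X cinner.add_left cinner.add_right cinner.scaleR_left cinner.scaleR_right
        blinfun.add_left blinfun.scaleR_left)
  moreover have "(\<lambda>n. cinner (blinfun_apply (sqrt_iter X n) x) y) \<longlonglongrightarrow> cinner (blinfun_apply Z x) y"
    by (intro cinner.tendsto blinfun.tendsto lim tendsto_const)
  moreover have "(\<lambda>n. cinner x (blinfun_apply (sqrt_iter X n) y)) \<longlonglongrightarrow> cinner x (blinfun_apply Z y)"
    by (intro cinner.tendsto blinfun.tendsto lim tendsto_const)
  ultimately show ?thesis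
    using LIMSEQ_unique by simp
qed

text \<open>\<open>R\<close> serves as an absolute value of \<open>W\<close>. For \<open>B\<close>,
  which is \<open>adj W \<circ> W\<close> divided by the square of \<open>K\<close>, and
  \<open>X = 1 - B\<close>, the limit \<open>Z\<close> makes \<open>1 - Z\<close> a square root of
  \<open>B\<close>, whence \<open>R = K (1 - Z)\<close>. The commutation property later brings the
  polar decomposition into the algebra.\<close>

lemma selfadjoint_sqrt_exists:
  fixes W :: "'a::chilbert_space \<Rightarrow> 'a"
  assumes W: "bounded_clinear W"
  obtains R where "bounded_clinear R" "adj R = R" "\<And>x. R (R x) = adj W (W x)"
    "\<And>C x. bounded_clinear C \<Longrightarrow> (\<And>x. C (adj W (W x)) = adj W (W (C x))) \<Longrightarrow> C (R x) = R (C x)"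
proof -
  obtain K where K0: "K > 0" and K: "\<And>x. norm (W x) \<le> K * norm x"
    using bounded_clinear_pos_bounded[OF W] by blast
  have aW: "bounded_clinear (adj W)"
    by (rule bounded_clinear_adj[OF W])
  define B where "B x = (1 / K\<^sup>2) *\<^sub>R adj W (W x)" for x
  have blB: "bounded_linear B"
    unfolding B_def
    by (intro bounded_linear_compose[OF bounded_linear_scaleR_right]
        bounded_linear_compose[OF bounded_clinear_bounded_linear[OF aW]]
        bounded_clinear_bounded_linear W)
  define X where "X = Blinfun (\<lambda>x. x - B x)"
  have X: "blinfun_apply X x = x - B x" for x
    unfolding X_def
    by (simp add: bounded_linear_Blinfun_apply bounded_linear_sub bounded_linear_ident blB)
  \<comment> \<open>In the expansion of the squared norm of \<open>x - B x\<close>, the last term is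
    at most \<open>inner (B x) x\<close>, which the cross term subtracts twice.\<close>
  have "norm (blinfun_apply X x) \<le> 1 * norm x" for x
  proof -
    have "cinner (adj W (W x)) x = cinner (W x) (W x)"
      by (rule cinner_adj'[OF W])
    then have "inner (B x) x = (norm (W x))\<^sup>2 / K\<^sup>2"
      by (simp add: B_def inner_eq_Re_cinner cinner_self cinner.scaleR_left)
    moreover have "(norm (B x))\<^sup>2 \<le> (norm (W x))\<^sup>2 / K\<^sup>2"
    proof -
      have "norm (B x) \<le> (K * norm (W x)) / K\<^sup>2"
        using norm_adj_le[OF W K, of "W x"] K0 by (simp add: B_def divide_right_mono)
      also have "\<dots> = norm (W x) / K"
        using K0 by (simp add: power2_eq_square)
      finally show ?thesis
        by (metis norm_ge_zero power_divide power_mono)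
    qed
    moreover have "(norm (x - B x))\<^sup>2 = (norm x)\<^sup>2 - 2 * inner (B x) x + (norm (B x))\<^sup>2"
      by (simp add: power2_norm_eq_inner inner_simps inner_commute)
    moreover have "0 \<le> (norm (W x))\<^sup>2 / K\<^sup>2"
      by simp
    ultimately have "(norm (x - B x))\<^sup>2 \<le> (norm x)\<^sup>2"
      by linarith
    then show ?thesis
      by (simp add: X power2_le_iff_abs_le)
  qed
  then have "norm X \<le> 1"
    by (intro norm_blinfun_bound) auto
  then obtain Z where lim: "sqrt_iter X \<longlonglongrightarrow> Z" and Z: "2 *\<^sub>R Z = X + (Z o\<^sub>L Z)"
    by (rule sqrt_iter_converges)
  have comm: "C (blinfun_apply Z x) = blinfun_apply Z (C x)"
    if "bounded_clinear C" "\<And>x. C (adj W (W x)) = adj W (W (C x))" for C x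
    using that
    by (intro sqrt_iter_commutes[OF lim])
      (auto simp: X B_def bounded_clinear_diff bounded_clinear_scaleC scaleR_scaleC
        bounded_clinear_bounded_linear)
  \<comment> \<open>\<open>Z\<close> is constructed as a limit of real-linear maps; complex
    homogeneity comes from applying \<open>comm\<close> to multiplication by
    \<open>c\<close>.\<close>
  have scC: "blinfun_apply Z (c *\<^sub>C x) = c *\<^sub>C blinfun_apply Z x" for c x
    by (rule comm[symmetric])
      (auto simp: bounded_clinear_def bounded_linear_scaleC scaleC_scaleC mult.commute
        bounded_clinear_scaleC[OF W] bounded_clinear_scaleC[OF aW])
  have saZ: "cinner (blinfun_apply Z x) y = cinner x (blinfun_apply Z y)" for x y
    by (rule sqrt_iter_selfadjoint[OF lim])
      (simp add: X B_def cinner_simps cinner.scaleR_left cinner.scaleR_right cinner_adj[OF W, symmetric]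
        cinner_adj'[OF W])
  define R where "R x = K *\<^sub>R (x - blinfun_apply Z x)" for x
  have blR: "bounded_linear R"
    unfolding R_def
    by (intro bounded_linear_compose[OF bounded_linear_scaleR_right] bounded_linear_sub
        bounded_linear_ident blinfun.bounded_linear_right)
  have "bounded_clinear R"
    unfolding bounded_clinear_def using blR
    by (auto simp: R_def scC scaleR_scaleC scaleC_scaleC mult.commute
        linear_simps[OF bounded_linear_scaleC])
  moreover have "adj R = R"
    by (rule adj_eqI) (simp add: R_def cinner_simps cinner.scaleR_left cinner.scaleR_right saZ)
  moreover have "R (R x) = adj W (W x)" for x
  proof -
    have "2 *\<^sub>R blinfun_apply Z x = x - B x + blinfun_apply Z (blinfun_apply Z x)"
      using arg_cong[OF Z, of "\<lambda>F. blinfun_apply F x"]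
      by (simp add: blinfun.add_left blinfun.scaleR_left X)
    then have "blinfun_apply Z (blinfun_apply Z x) = 2 *\<^sub>R blinfun_apply Z x - x + B x"
      by (simp add: algebra_simps)
    then have "R (R x) = (K * K) *\<^sub>R B x"
      by (simp add: R_def blinfun.scaleR_right blinfun.diff_right scaleR_2 flip: scaleR_diff_right)
    then show ?thesis
      using K0 by (simp add: B_def power2_eq_square)
  qed
  moreover have "C (R x) = R (C x)"
    if "bounded_clinear C" "\<And>x. C (adj W (W x)) = adj W (W (C x))" for C x
    using that comm[OF that]
    by (simp add: R_def scaleR_scaleC bounded_clinear_scaleC bounded_clinear_diff)
  ultimately show thesis
    using that by blast
qed

section \<open>Polar decomposition\<close>

text \<open>Taking complements twice preserves inclusions and fixes \<open>K\<close>. Thus the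
  double complement acts as the closed linear span.\<close>

lemma orth_compl_least:
  assumes "closed_csubspace K" "X \<subseteq> K"
  shows "orth_compl (orth_compl X) \<subseteq> K"
  using orth_compl_antimono[OF orth_compl_antimono[OF assms(2)]] orth_compl_orth_compl[OF assms(1)]
  by simp

lemma orth_compl_triple: "orth_compl (orth_compl (orth_compl X)) = orth_compl X"
  by (rule orth_compl_orth_compl[OF closed_csubspace_orth_compl])

text \<open>Split a vector along the double complement of \<open>X\<close>: one component is in
  \<open>K\<close> by \<open>orth_compl_least\<close>, the other in the complement of
  \<open>X\<close>. Consequently, operator identities can be checked on \<open>X\<close> and on its
  complement.\<close>

lemma closed_csubspace_eq_UNIV:
  assumes K: "closed_csubspace K" and "X \<subseteq> K" "orth_compl X \<subseteq> K"
  shows "K = UNIV"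
proof -
  let ?L = "orth_compl (orth_compl X)"
  have "x \<in> K" for x
  proof -
    have "Proj ?L x \<in> K"
      using orth_compl_least[OF assms(1,2)] Proj_in[OF closed_csubspace_orth_compl] by blast
    moreover have "x - Proj ?L x \<in> K"
      using Proj_diff_in[OF closed_csubspace_orth_compl, of x "orth_compl X"] assms(3)
      by (auto simp: orth_compl_triple)
    ultimately have "Proj ?L x + (x - Proj ?L x) \<in> K"
      by (rule closed_csubspace_add[OF K])
    then show ?thesis
      by simp
  qed
  then show ?thesis
    by blast
qed

lemma bounded_clinear_sub:
  "bounded_clinear F \<Longrightarrow> bounded_clinear G \<Longrightarrow> bounded_clinear (\<lambda>x. F x - G x)"
  unfolding bounded_clinear_def by (simp add: bounded_linear_sub linear_simps[OF bounded_linear_scaleC])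

lemma bounded_clinear_eqI:
  assumes F: "bounded_clinear F" and G: "bounded_clinear G"
    and "\<And>x. x \<in> X \<Longrightarrow> F x = G x" "\<And>x. x \<in> orth_compl X \<Longrightarrow> F x = G x"
  shows "F = G"
proof -
  have "ker (\<lambda>x. F x - G x) = UNIV"
    by (rule closed_csubspace_eq_UNIV[OF closed_csubspace_ker[OF bounded_clinear_sub[OF F G]], where X = X])
      (use assms in \<open>auto simp: ker_def\<close>)
  then show ?thesis
    by (auto simp: ker_def)
qed

lemma closed_csubspace_vimage:
  assumes V: "bounded_clinear V" and L: "closed_csubspace L"
  shows "closed_csubspace (V -` L)"
proof -
  have "closed (V -` L)"
    by (intro continuous_closed_vimage linear_continuous_at bounded_clinear_bounded_linear[OF V]
        closed_csubspace_closed[OF L])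
  then show ?thesis
    using L by (simp add: closed_csubspace_def bounded_clinear_add[OF V] bounded_clinear_zero[OF V]
        bounded_clinear_scaleC[OF V])
qed

text \<open>The closure of the range is a closed subspace, so \<open>orth_compl_least\<close>
  applies. It allows vectors of the double complement to be approximated by values of
  \<open>R\<close>.\<close>

lemma orth_compl_orth_compl_range_subset_closure:
  fixes R :: "'a::chilbert_space \<Rightarrow> 'a"
  assumes R: "bounded_clinear R"
  shows "orth_compl (orth_compl (range R)) \<subseteq> closure (range R)"
proof (rule orth_compl_least)
  show "closed_csubspace (closure (range R))"
    unfolding closed_csubspace_def
  proof (intro conjI ballI allI)
    show "0 \<in> closure (range R)"
      using subsetD[OF closure_subset rangeI[of R 0]] by (simp add: bounded_clinear_zero[OF R])
    fix x assume "x \<in> closure (range R)"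
    then obtain u where u: "\<And>n. u n \<in> range R" "u \<longlonglongrightarrow> x"
      unfolding closure_sequential by blast
    show "c *\<^sub>C x \<in> closure (range R)" for c
    proof -
      have "c *\<^sub>C u n \<in> range R" for n
      proof -
        obtain a where "u n = R a"
          using u(1)[of n] by blast
        then have "c *\<^sub>C u n = R (c *\<^sub>C a)"
          by (simp add: bounded_clinear_scaleC[OF R])
        then show ?thesis
          by simp
      qed
      moreover have "(\<lambda>n. c *\<^sub>C u n) \<longlonglongrightarrow> c *\<^sub>C x"
        by (rule bounded_linear.tendsto[OF bounded_linear_scaleC u(2)])
      ultimately show ?thesis
        unfolding closure_sequential by (intro exI[of _ "\<lambda>n. c *\<^sub>C u n"] conjI allI)
    qed
    fix y assume "y \<in> closure (range R)"
    then obtain v where v: "\<And>n. v n \<in> range R" "v \<longlonglongrightarrow> y"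
      unfolding closure_sequential by blast
    have "u n + v n \<in> range R" for n
    proof -
      obtain a b where "u n = R a" "v n = R b"
        using u(1)[of n] v(1)[of n] by blast
      then have "u n + v n = R (a + b)"
        by (simp add: bounded_clinear_add[OF R])
      then show ?thesis
        by simp
    qed
    moreover have "(\<lambda>n. u n + v n) \<longlonglongrightarrow> x + y"
      by (intro tendsto_add u v)
    ultimately show "x + y \<in> closure (range R)"
      unfolding closure_sequential by (intro exI[of _ "\<lambda>n. u n + v n"] conjI allI)
  qed simp
qed (rule closure_subset)

text \<open>Equality of norms makes the assignment of \<open>W x\<close> to \<open>R x\<close> well
  defined and isometric on the range of \<open>R\<close>; it extends by limits to the closure and by
  zero to the complement.\<close>

lemma partial_isometry_extension:
  fixes R W :: "'a::chilbert_space \<Rightarrow> 'a"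
  assumes R: "bounded_clinear R" and W: "bounded_clinear W"
    and iso: "\<And>x. norm (W x) = norm (R x)"
  obtains V where "bounded_clinear V" "\<And>x. V (R x) = W x"
    "\<And>x. x \<in> orth_compl (range R) \<Longrightarrow> V x = 0"
proof -
  define L where "L = orth_compl (orth_compl (range R))"
  have L: "closed_csubspace L"
    by (simp add: L_def closed_csubspace_orth_compl)
  note P = bounded_clinear_Proj[OF L]
  note blR = bounded_clinear_bounded_linear[OF R] and blW = bounded_clinear_bounded_linear[OF W]
  \<comment> \<open>The graph of the map sought: \<open>v\<close> is a limit of \<open>W\<close>
    along a sequence on which \<open>R\<close> approaches the projection of \<open>y\<close>.
    Linearity and uniqueness are shown for this relation before a function is chosen.\<close>
  define G where "G y v \<longleftrightarrow> (\<exists>x. (\<lambda>n. R (x n)) \<longlonglongrightarrow> Proj L y \<and> (\<lambda>n. W (x n)) \<longlonglongrightarrow> v)" for y v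
  have G_ex: "\<exists>v. G y v" for y
  proof -
    have "Proj L y \<in> closure (range R)"
      using Proj_in[OF L] orth_compl_orth_compl_range_subset_closure[OF R] by (auto simp: L_def)
    then obtain u where u: "\<And>n. u n \<in> range R" "u \<longlonglongrightarrow> Proj L y"
      unfolding closure_sequential by blast
    from u(1) have "\<exists>x. \<forall>n. u n = R (x n)"
      by (intro choice) blast
    then obtain x where "u = (\<lambda>n. R (x n))"
      by blast
    with u(2) have x: "(\<lambda>n. R (x n)) \<longlonglongrightarrow> Proj L y"
      by simp
    then have "Cauchy (\<lambda>n. R (x n))"
      by (rule LIMSEQ_imp_Cauchy)
    moreover have "norm (W (x m) - W (x n)) = norm (R (x m) - R (x n))" for m n
      using iso[of "x m - x n"] by (simp add: bounded_clinear_diff R W)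
    ultimately have "Cauchy (\<lambda>n. W (x n))"
      by (simp add: Cauchy_def dist_norm)
    then obtain v where "(\<lambda>n. W (x n)) \<longlonglongrightarrow> v"
      using Cauchy_convergent_iff convergent_def by blast
    then show ?thesis
      using x by (auto simp: G_def)
  qed
  have G_norm: "norm v = norm (Proj L y)" if g: "G y v" for y v
  proof -
    obtain x where "(\<lambda>n. R (x n)) \<longlonglongrightarrow> Proj L y" "(\<lambda>n. W (x n)) \<longlonglongrightarrow> v"
      using g unfolding G_def by blast
    note this[THEN tendsto_norm]
    then show ?thesis
      using LIMSEQ_unique unfolding iso by blast
  qed
  have G_add: "G (y + z) (v + w)" if g: "G y v" "G z w" for y z v w
  proof -
    obtain x x' where "(\<lambda>n. R (x n)) \<longlonglongrightarrow> Proj L y" "(\<lambda>n. W (x n)) \<longlonglongrightarrow> v"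
      "(\<lambda>n. R (x' n)) \<longlonglongrightarrow> Proj L z" "(\<lambda>n. W (x' n)) \<longlonglongrightarrow> w"
      using g unfolding G_def by blast
    then show ?thesis
      unfolding G_def
      by (intro exI[of _ "\<lambda>n. x n + x' n"])
        (auto simp: bounded_clinear_add R W P intro: tendsto_add)
  qed
  have G_scaleC: "G (c *\<^sub>C y) (c *\<^sub>C v)" if g: "G y v" for c y v
  proof -
    obtain x where "(\<lambda>n. R (x n)) \<longlonglongrightarrow> Proj L y" "(\<lambda>n. W (x n)) \<longlonglongrightarrow> v"
      using g unfolding G_def by blast
    then show ?thesis
      unfolding G_def
      by (intro exI[of _ "\<lambda>n. c *\<^sub>C x n"])
        (auto simp: bounded_clinear_scaleC R W P
          intro: bounded_linear.tendsto[OF bounded_linear_scaleC])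
  qed
  have G_unique: "v = w" if "G y v" "G y w" for y v w
  proof -
    \<comment> \<open>By linearity of the graph, the difference of two values belongs to the vector
      \<open>0\<close>, and \<open>G_norm\<close> makes it vanish.\<close>
    have "G (y + (- 1) *\<^sub>R y) (v + (- 1) *\<^sub>R w)"
      unfolding scaleR_scaleC by (intro G_add G_scaleC that)
    then have "norm (v - w) = norm (Proj L 0)"
      using G_norm[of "y + (- 1) *\<^sub>R y" "v + (- 1) *\<^sub>R w"] by simp
    then show ?thesis
      by (simp add: bounded_clinear_zero[OF P])
  qed
  obtain V where V: "\<And>y. G y (V y)"
    using G_ex by metis
  have V_eq: "V y = v" if "G y v" for y v
    using G_unique V that by blast
  have "bounded_clinear V"
  proof (rule bounded_clinearI[where K = 1])
    show "V (x + y) = V x + V y" "V (c *\<^sub>C x) = c *\<^sub>C V x" for x y c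
      by (intro V_eq G_add G_scaleC V)+
    show "norm (V x) \<le> 1 * norm x" for x
      using G_norm[OF V] norm_Proj_le[OF L] by simp
  qed
  moreover have "V (R x) = W x" for x
  proof (rule V_eq)
    have "R x \<in> L"
      using subset_orth_compl_orth_compl[of "range R"] by (auto simp: L_def)
    then show "G (R x) (W x)"
      unfolding G_def by (intro exI[of _ "\<lambda>_. x"]) (simp add: Proj_fixes[OF L])
  qed
  moreover have "V x = 0" if "x \<in> orth_compl (range R)" for x
  proof -
    have "Proj L x = 0"
      by (rule Proj_orth_eq_zero[OF L]) (simp add: L_def orth_compl_triple that)
    then show ?thesis
      using G_norm[OF V, of x] by simp
  qed
  ultimately show thesis
    using that by blast
qed

section \<open>Von Neumann algebras and their affiliated subspaces\<close>

lemma von_neumann_bounded_clinear: "von_neumann_algebra A \<Longrightarrow> T \<in> A \<Longrightarrow> bounded_clinear T"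
  and von_neumann_add: "von_neumann_algebra A \<Longrightarrow> S \<in> A \<Longrightarrow> T \<in> A \<Longrightarrow> (\<lambda>x. S x + T x) \<in> A"
  and von_neumann_compose: "von_neumann_algebra A \<Longrightarrow> S \<in> A \<Longrightarrow> T \<in> A \<Longrightarrow> S \<circ> T \<in> A"
  and von_neumann_adj: "von_neumann_algebra A \<Longrightarrow> T \<in> A \<Longrightarrow> adj T \<in> A"
  unfolding von_neumann_algebra_def by blast+

text \<open>An operator commuting with the commutant lies in the bicommutant, which is
  \<open>A\<close>. This is how projections and the polar partial isometry are placed in
  \<open>A\<close>.\<close>

lemma von_neumann_memberI:
  assumes A: "von_neumann_algebra A" and B: "bounded_clinear B"
    and comm: "\<And>C x. C \<in> commutant A \<Longrightarrow> C (B x) = B (C x)"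
  shows "B \<in> A"
proof -
  have "B \<circ> C = C \<circ> B" if "C \<in> commutant A" for C
    by (rule ext) (simp only: comp_apply comm[OF that])
  then have "B \<in> commutant (commutant A)"
    unfolding commutant_def[of "commutant A"] using B by blast
  moreover have "commutant (commutant A) = A"
    using A unfolding von_neumann_algebra_def by blast
  ultimately show ?thesis
    by (rule back_subst[where P = "\<lambda>X. B \<in> X"])
qed

lemma commutantD:
  assumes "C \<in> commutant A"
  shows "bounded_clinear C" "T \<in> A \<Longrightarrow> C (T x) = T (C x)"
proof -
  show "bounded_clinear C"
    using assms unfolding commutant_def by blast
  assume "T \<in> A"
  then have "C \<circ> T = T \<circ> C"
    using assms unfolding commutant_def by blast
  then show "C (T x) = T (C x)"
    by (rule comp_eq_dest)
qed

text \<open>\<open>A\<close> is closed under adjoints, so commutation of \<open>C\<close> with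
  \<open>adj T\<close> becomes commutation of \<open>adj C\<close> with \<open>T\<close>. It makes
  invariance under the commutant pass to orthogonal complements.\<close>

lemma commutant_adj:
  assumes A: "von_neumann_algebra A" and C: "C \<in> commutant A"
  shows "adj C \<in> commutant A"
proof -
  note bC = commutantD(1)[OF C]
  have comm: "adj C (T x) = T (adj C x)" if T: "T \<in> A" for T x
  proof (rule cinner_ext_right)
    fix z
    note bT = von_neumann_bounded_clinear[OF A T]
    show "cinner z (adj C (T x)) = cinner z (T (adj C x))"
      by (simp only: cinner_adj[OF bC, symmetric] cinner_adj'[OF bT, symmetric]
          commutantD(2)[OF C von_neumann_adj[OF A T]])
  qed
  have "adj C \<circ> T = T \<circ> adj C" if "T \<in> A" for T
    by (rule ext) (simp only: comp_apply comm[OF that])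
  then show ?thesis
    using bounded_clinear_adj[OF bC] unfolding commutant_def by blast
qed

text \<open>The closed subspaces whose projections belong to \<open>A\<close>.\<close>

definition affiliated :: "('a::chilbert_space \<Rightarrow> 'a) set \<Rightarrow> 'a set \<Rightarrow> bool"
  where "affiliated A L \<longleftrightarrow> closed_csubspace L \<and> (\<forall>C\<in>commutant A. \<forall>x\<in>L. C x \<in> L)"

lemma affiliated_closed_csubspace: "affiliated A L \<Longrightarrow> closed_csubspace L"
  by (simp add: affiliated_def)

lemma affiliated_Int: "affiliated A K \<Longrightarrow> affiliated A L \<Longrightarrow> affiliated A (K \<inter> L)"
  by (auto simp: affiliated_def closed_csubspace_Int)

lemma affiliated_ker:
  assumes "von_neumann_algebra A" "T \<in> A"
  shows "affiliated A (ker T)"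
  unfolding affiliated_def
proof (intro conjI ballI)
  fix C x assume C: "C \<in> commutant A" and "x \<in> ker T"
  then have "T (C x) = C 0"
    using commutantD(2)[OF C assms(2), of x] by (simp add: ker_def)
  then show "C x \<in> ker T"
    by (simp add: ker_def bounded_clinear_zero[OF commutantD(1)[OF C]])
qed (intro closed_csubspace_ker von_neumann_bounded_clinear[OF assms])

lemma affiliated_orth_compl:
  assumes A: "von_neumann_algebra A" and L: "affiliated A L"
  shows "affiliated A (orth_compl L)"
  unfolding affiliated_def
proof (intro conjI ballI)
  fix C x assume C: "C \<in> commutant A" and x: "x \<in> orth_compl L"
  show "C x \<in> orth_compl L"
  proof (rule orth_complI)
    fix y assume "y \<in> L"
    then have "adj C y \<in> L"
      using L commutant_adj[OF A C] by (auto simp: affiliated_def)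
    then show "cinner (C x) y = 0"
      using x by (simp add: cinner_adj[OF commutantD(1)[OF C]] orth_complD)
  qed
qed (rule closed_csubspace_orth_compl)

lemma affiliated_orth_compl_range:
  assumes "von_neumann_algebra A" "T \<in> A"
  shows "affiliated A (orth_compl (range T))"
  using affiliated_ker[OF assms(1) von_neumann_adj[OF assms]]
  by (simp add: orth_compl_range von_neumann_bounded_clinear[OF assms])

text \<open>Both \<open>L\<close> and its complement are invariant under the commutant, so each
  \<open>C\<close> there respects the orthogonal decomposition and commutes with
  \<open>Proj L\<close>.\<close>

lemma affiliated_Proj:
  assumes A: "von_neumann_algebra A" and L: "affiliated A L"
  shows "Proj L \<in> A"
proof (rule von_neumann_memberI[OF A])
  note cL = affiliated_closed_csubspace[OF L]
  show "bounded_clinear (Proj L)"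
    by (rule bounded_clinear_Proj[OF cL])
  fix C x assume C: "C \<in> commutant A"
  have "C (Proj L x) \<in> L"
    using L C Proj_in[OF cL] by (auto simp: affiliated_def)
  moreover have "C (x - Proj L x) \<in> orth_compl L"
    using affiliated_orth_compl[OF A L] C Proj_diff_in[OF cL] by (auto simp: affiliated_def)
  ultimately show "C (Proj L x) = Proj L (C x)"
    using Proj_eqI[OF cL] by (simp add: bounded_clinear_diff[OF commutantD(1)[OF C]])
qed

text \<open>The square root \<open>R\<close> of \<open>adj W \<circ> W\<close> has the same norms as
  \<open>W\<close>, so a partial isometry \<open>V\<close> carries \<open>R x\<close> to
  \<open>W x\<close>. Its initial space is the complement of \<open>ker W\<close>; its final space
  is the closure of the image, written as a double complement.\<close>

theorem polar_decomposition_mvn_equiv: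
  fixes W :: "'a::chilbert_space \<Rightarrow> 'a"
  assumes A: "von_neumann_algebra A" and W: "W \<in> A"
  shows "mvn_equiv A (Proj (orth_compl (orth_compl (range W)))) (Proj (orth_compl (ker W)))"
proof -
  note bW = von_neumann_bounded_clinear[OF A W]
  obtain R where R: "bounded_clinear R" "adj R = R" and RR: "\<And>x. R (R x) = adj W (W x)"
    and Rc: "\<And>C x. bounded_clinear C \<Longrightarrow> (\<And>x. C (adj W (W x)) = adj W (W (C x))) \<Longrightarrow> C (R x) = R (C x)"
    using selfadjoint_sqrt_exists[OF bW] by blast
  have inner_eq: "cinner (W x) (W y) = cinner (R x) (R y)" for x y
    using cinner_adj[OF bW, of x "W y"] cinner_adj[OF R(1), of x "R y"] by (simp add: R RR)
  have iso: "norm (W x) = norm (R x)" for x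
  proof -
    have "(norm (W x))\<^sup>2 = (norm (R x))\<^sup>2"
      by (simp add: power2_norm_eq_inner inner_eq_Re_cinner inner_eq)
    then show ?thesis
      by (simp add: power2_eq_iff_nonneg)
  qed
  obtain V where V: "bounded_clinear V" and VR: "\<And>x. V (R x) = W x"
    and V0: "\<And>x. x \<in> orth_compl (range R) \<Longrightarrow> V x = 0"
    using partial_isometry_extension[OF R(1) bW iso] by blast
  note aV = bounded_clinear_adj[OF V]
  have oR: "orth_compl (range R) = ker R"
    by (simp add: orth_compl_range R)
  have kR: "ker R = ker W"
    by (auto simp: ker_def) (metis iso norm_eq_zero)+
  define L where "L = orth_compl (orth_compl (range R))"
  define M where "M = orth_compl (orth_compl (range W))"
  have cL: "closed_csubspace L" and cM: "closed_csubspace M"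
    by (simp_all add: L_def M_def closed_csubspace_orth_compl)
  have L_eq: "L = orth_compl (ker W)"
    by (simp add: L_def oR kR)
  have RL: "R x \<in> L" and WM: "W x \<in> M" for x
    using subset_orth_compl_orth_compl[of "range R"] subset_orth_compl_orth_compl[of "range W"]
    by (auto simp: L_def M_def)
  have "V \<in> A"
  proof (rule von_neumann_memberI[OF A V])
    fix C x assume C: "C \<in> commutant A"
    note bC = commutantD(1)[OF C]
    have CR: "C (R x) = R (C x)" for x
      by (rule Rc[OF bC]) (simp add: commutantD(2)[OF C] W von_neumann_adj[OF A])
    \<comment> \<open>On the range of \<open>R\<close> this holds because \<open>C\<close> commutes
      with \<open>R\<close> and \<open>W\<close>; the complement is the kernel of \<open>R\<close>,
      which \<open>C\<close> preserves and \<open>V\<close> annihilates.\<close>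
    have "C \<circ> V = V \<circ> C"
    proof (rule bounded_clinear_eqI[where X = "range R"])
      fix x assume "x \<in> range R"
      then show "(C \<circ> V) x = (V \<circ> C) x"
        by (auto simp: VR CR commutantD(2)[OF C W])
    next
      fix x assume x: "x \<in> orth_compl (range R)"
      then have "C x \<in> orth_compl (range R)"
        using CR[of x] by (simp add: oR ker_def bounded_clinear_zero[OF bC])
      then show "(C \<circ> V) x = (V \<circ> C) x"
        using x by (simp add: V0 bounded_clinear_zero[OF bC])
    qed (intro bounded_clinear_compose bC V)+
    then show "C (V x) = V (C x)"
      by (simp add: fun_eq_iff)
  qed
  moreover have aVW: "adj V (W x) = R x" for x
  proof -
    \<comment> \<open>The difference is orthogonal to the range of \<open>R\<close>, as
      \<open>R\<close> and \<open>W\<close> give the same inner products, yet it also lies in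
      \<open>L\<close>, so it is zero.\<close>
    have "adj V (W x) - R x \<in> orth_compl (range R)"
    proof (rule orth_complI)
      fix y assume "y \<in> range R"
      then show "cinner (adj V (W x) - R x) y = 0"
        by (auto simp: cinner.diff_left cinner_adj'[OF V] VR inner_eq)
    qed
    moreover have "adj V (W x) \<in> L"
      unfolding L_def by (rule orth_complI) (simp add: cinner_adj'[OF V] V0)
    then have "adj V (W x) - R x \<in> L"
      using RL by (intro closed_csubspace_diff cL)
    ultimately have "adj V (W x) - R x = 0"
      unfolding L_def by (rule Int_orth_compl)
    then show ?thesis
      by simp
  qed
  have "adj V \<circ> V = Proj L"
  proof (rule bounded_clinear_eqI[where X = "range R"])
    fix x assume "x \<in> range R"
    then show "(adj V \<circ> V) x = Proj L x"
      using RL by (auto simp: VR aVW Proj_fixes[OF cL])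
  next
    fix x assume x: "x \<in> orth_compl (range R)"
    then have "Proj L x = 0"
      by (intro Proj_orth_eq_zero[OF cL]) (simp add: L_def orth_compl_triple)
    then show "(adj V \<circ> V) x = Proj L x"
      using x by (simp add: V0 bounded_clinear_zero[OF aV])
  qed (intro bounded_clinear_compose bounded_clinear_Proj aV V cL)+
  moreover have "V \<circ> adj V = Proj M"
  proof (rule bounded_clinear_eqI[where X = "range W"])
    fix x assume "x \<in> range W"
    then show "(V \<circ> adj V) x = Proj M x"
      using WM by (auto simp: VR aVW Proj_fixes[OF cM])
  next
    fix x assume x: "x \<in> orth_compl (range W)"
    \<comment> \<open>All values of \<open>V\<close> lie in \<open>M\<close>, so
      \<open>adj V\<close> annihilates every vector orthogonal to \<open>M\<close>.\<close>
    have "V -` M = UNIV"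
      by (rule closed_csubspace_eq_UNIV[OF closed_csubspace_vimage[OF V cM], where X = "range R"])
        (auto simp: VR V0 WM closed_csubspace_zero[OF cM])
    then have "V y \<in> M" for y
      by blast
    moreover have "x \<in> orth_compl M"
      using x by (simp add: M_def orth_compl_triple)
    ultimately have "cinner (adj V x) (adj V x) = 0"
      by (simp add: cinner_adj'[OF V] orth_complD)
    then have "adj V x = 0"
      by (simp add: cinner_self_eq_zero)
    then show "(V \<circ> adj V) x = Proj M x"
      using \<open>x \<in> orth_compl M\<close> by (simp add: Proj_orth_eq_zero[OF cM] bounded_clinear_zero[OF V])
  qed (intro bounded_clinear_compose bounded_clinear_Proj aV V cM)+
  ultimately show ?thesis
    unfolding mvn_equiv_def L_eq M_def by blast
qed

section \<open>Equivalence of projections\<close>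

lemma mvn_equiv_sym:
  assumes A: "von_neumann_algebra A" and "mvn_equiv A P Q"
  shows "mvn_equiv A Q P"
  using assms von_neumann_adj[OF A] adj_adj von_neumann_bounded_clinear[OF A]
  unfolding mvn_equiv_def by metis

lemma mvn_equiv_refl:
  assumes "P \<in> A" "is_projection P"
  shows "mvn_equiv A P P"
  using assms unfolding mvn_equiv_def is_projection_def by metis

text \<open>For the composite \<open>V \<circ> U\<close>, the middle projection \<open>Q\<close> can
  be rewritten as \<open>adj V \<circ> V\<close> or as \<open>U \<circ> adj U\<close>, and the two
  products collapse to \<open>P \<circ> P\<close> and \<open>E \<circ> E\<close>.\<close>

lemma mvn_equiv_trans:
  assumes A: "von_neumann_algebra A" and "mvn_equiv A P Q" "mvn_equiv A Q E"
    and P: "P \<circ> P = P" and E: "E \<circ> E = E"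
  shows "mvn_equiv A P E"
proof -
  obtain V where V: "V \<in> A" "V \<circ> adj V = P" "adj V \<circ> V = Q"
    using assms(2) by (auto simp: mvn_equiv_def)
  obtain U where U: "U \<in> A" "U \<circ> adj U = Q" "adj U \<circ> U = E"
    using assms(3) by (auto simp: mvn_equiv_def)
  have adj: "adj (V \<circ> U) = adj U \<circ> adj V"
    by (intro adj_compose von_neumann_bounded_clinear[OF A] V U)
  have "(V \<circ> U) \<circ> (adj U \<circ> adj V) = (V \<circ> adj V) \<circ> (V \<circ> adj V)"
    using U(2) V(3) by (metis comp_assoc)
  moreover have "(adj U \<circ> adj V) \<circ> (V \<circ> U) = (adj U \<circ> U) \<circ> (adj U \<circ> U)"
    using U(2) V(3) by (metis comp_assoc)
  ultimately show ?thesis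
    unfolding mvn_equiv_def
    using von_neumann_compose[OF A V(1) U(1)] adj P E V(2) U(3) by metis
qed

text \<open>The squared norm of \<open>V (x - Q x)\<close> is
  \<open>cinner (x - Q x) (Q (x - Q x))\<close>, and \<open>Q\<close> kills \<open>x - Q x\<close>.
  So \<open>V\<close> lives on the range of \<open>Q\<close>, and dually \<open>adj V\<close> maps
  into it.\<close>

lemma partial_isometry_initial:
  assumes V: "bounded_clinear V" and Q: "adj V \<circ> V = Q" "Q \<circ> Q = Q"
  shows "V (Q x) = V x" "adj V x = Q (adj V x)"
proof -
  have Q1: "adj V (V x) = Q x" "Q (Q x) = Q x" for x
    using Q by (auto simp: fun_eq_iff)
  have bQ: "bounded_clinear Q"
    unfolding Q(1)[symmetric] by (intro bounded_clinear_compose bounded_clinear_adj V)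
  have "cinner (V (x - Q x)) (V (x - Q x)) = cinner (x - Q x) (Q (x - Q x))" for x
    by (simp only: cinner_adj[OF V] Q1)
  then have "V (x - Q x) = 0" for x
    by (simp add: bounded_clinear_diff[OF bQ] Q1 cinner_self_eq_zero)
  then show *: "V (Q x) = V x" for x
    by (simp add: bounded_clinear_diff[OF V])
  have "cinner z (adj V x) = cinner z (Q (adj V x))" for z
  proof -
    have "cinner z (adj V x) = cinner (V (Q z)) x"
      by (simp add: * cinner_adj[OF V])
    also have "\<dots> = cinner (V z) (V (adj V x))"
      by (simp add: cinner_adj[OF V] cinner_adj'[OF V] flip: Q1(1))
    also have "\<dots> = cinner z (Q (adj V x))"
      by (simp add: cinner_adj[OF V] Q1)
    finally show ?thesis .
  qed
  then show "adj V x = Q (adj V x)"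
    by (rule cinner_ext_right)
qed

text \<open>The sum of the two partial isometries works, since inserting their initial and final
  projections makes all mixed products vanish by orthogonality.\<close>

lemma mvn_equiv_add:
  assumes A: "von_neumann_algebra A" and eq: "mvn_equiv A P1 Q1" "mvn_equiv A P2 Q2"
    and idem: "P1 \<circ> P1 = P1" "P2 \<circ> P2 = P2" "Q1 \<circ> Q1 = Q1" "Q2 \<circ> Q2 = Q2"
    and orth: "\<And>x. P1 (P2 x) = 0" "\<And>x. P2 (P1 x) = 0" "\<And>x. Q1 (Q2 x) = 0" "\<And>x. Q2 (Q1 x) = 0"
  shows "mvn_equiv A (\<lambda>x. P1 x + P2 x) (\<lambda>x. Q1 x + Q2 x)"
proof -
  obtain V1 where V1: "V1 \<in> A" "V1 \<circ> adj V1 = P1" "adj V1 \<circ> V1 = Q1"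
    using eq(1) by (auto simp: mvn_equiv_def)
  obtain V2 where V2: "V2 \<in> A" "V2 \<circ> adj V2 = P2" "adj V2 \<circ> V2 = Q2"
    using eq(2) by (auto simp: mvn_equiv_def)
  note b = von_neumann_bounded_clinear[OF A V1(1)] von_neumann_bounded_clinear[OF A V2(1)]
  note ab = bounded_clinear_adj[OF b(1)] bounded_clinear_adj[OF b(2)]
  note i1 = partial_isometry_initial[OF b(1) V1(3) idem(3)]
  note i2 = partial_isometry_initial[OF b(2) V2(3) idem(4)]
  \<comment> \<open>The same facts for the adjoints, whose initial projections are \<open>P1\<close>
    and \<open>P2\<close>.\<close>
  note f1 = partial_isometry_initial[OF ab(1), unfolded adj_adj[OF b(1)], OF V1(2) idem(1)]
  note f2 = partial_isometry_initial[OF ab(2), unfolded adj_adj[OF b(2)], OF V2(2) idem(2)]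
  have cross: "V1 (adj V2 x) = 0" "V2 (adj V1 x) = 0" "adj V1 (V2 x) = 0" "adj V2 (V1 x) = 0" for x
  proof -
    have "V1 (Q1 (Q2 (adj V2 x))) = 0" "V2 (Q2 (Q1 (adj V1 x))) = 0"
      "adj V1 (P1 (P2 (V2 x))) = 0" "adj V2 (P2 (P1 (V1 x))) = 0"
      by (simp_all add: orth bounded_clinear_zero b ab)
    then show "V1 (adj V2 x) = 0" "V2 (adj V1 x) = 0" "adj V1 (V2 x) = 0" "adj V2 (V1 x) = 0"
      by (simp_all only: i1(1) i2(1) f1(1) f2(1) i1(2)[symmetric] i2(2)[symmetric]
          f1(2)[symmetric] f2(2)[symmetric])
  qed
  define V where "V x = V1 x + V2 x" for x
  have "V \<in> A"
    unfolding V_def[abs_def] by (intro von_neumann_add[OF A] V1 V2)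
  moreover have aV: "adj V = (\<lambda>x. adj V1 x + adj V2 x)"
    by (rule adj_eqI) (simp add: V_def cinner_simps cinner_adj b)
  have "V \<circ> adj V = (\<lambda>x. P1 x + P2 x)"
    unfolding aV V1(2)[symmetric] V2(2)[symmetric]
    by (auto simp: V_def fun_eq_iff bounded_clinear_add b cross)
  moreover have "adj V \<circ> V = (\<lambda>x. Q1 x + Q2 x)"
    unfolding aV V1(3)[symmetric] V2(3)[symmetric]
    by (auto simp: V_def fun_eq_iff bounded_clinear_add ab cross)
  ultimately show ?thesis
    unfolding mvn_equiv_def by blast
qed

section \<open>Orthogonal sums, kernels of compositions and pairs of subspaces\<close>

lemma is_orth_sumE:
  assumes "is_orth_sum M K L" "z \<in> M"
  obtains x y where "z = x + y" "x \<in> K" "y \<in> L"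
  using assms unfolding is_orth_sum_def by blast

lemma is_orth_sum_relative_complement:
  assumes K: "closed_csubspace K" and N: "closed_csubspace N" and "K \<subseteq> N"
  shows "is_orth_sum N K (N \<inter> orth_compl K)"
  unfolding is_orth_sum_def
proof (intro conjI)
  show "\<forall>x\<in>K. \<forall>y\<in>N \<inter> orth_compl K. cinner x y = 0"
    by (auto intro: orth_complD)
  show "N = {x + y |x y. x \<in> K \<and> y \<in> N \<inter> orth_compl K}"
  proof (intro equalityI subsetI)
    fix x assume x: "x \<in> N"
    have "x = Proj K x + (x - Proj K x)"
      by simp
    moreover have "x - Proj K x \<in> N \<inter> orth_compl K"
      using Proj_in[OF K] Proj_diff_in[OF K] \<open>K \<subseteq> N\<close> x by (auto intro: closed_csubspace_diff[OF N])
    ultimately show "x \<in> {x + y |x y. x \<in> K \<and> y \<in> N \<inter> orth_compl K}"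
      using Proj_in[OF K] by blast
  qed (use \<open>K \<subseteq> N\<close> closed_csubspace_add[OF N] in blast)
qed

text \<open>Turns an orthogonal splitting of \<open>N\<close> into a sum of projections, the form in
  which \<open>mvn_equiv_add\<close> combines equivalences.\<close>

lemma Proj_relative_complement:
  assumes K: "closed_csubspace K" and N: "closed_csubspace N" and "K \<subseteq> N"
  shows "Proj N = (\<lambda>x. Proj K x + Proj (N \<inter> orth_compl K) x)"
proof
  fix x
  let ?D = "N \<inter> orth_compl K"
  have D: "closed_csubspace ?D"
    by (intro closed_csubspace_Int N closed_csubspace_orth_compl)
  show "Proj N x = Proj K x + Proj ?D x"
  proof (rule Proj_eqI[OF N])
    show "Proj K x + Proj ?D x \<in> N"
      using Proj_in[OF K] Proj_in[OF D] \<open>K \<subseteq> N\<close> by (intro closed_csubspace_add[OF N]) auto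
    show "x - (Proj K x + Proj ?D x) \<in> orth_compl N"
    proof (rule orth_complI)
      fix y assume "y \<in> N"
      then obtain k d where y: "y = k + d" and k: "k \<in> K" and d: "d \<in> ?D"
        using is_orth_sum_relative_complement[OF assms] by (blast elim: is_orth_sumE)
      have "cinner (x - Proj K x) k = 0" "cinner (x - Proj ?D x) d = 0"
        "cinner (Proj ?D x) k = 0" "cinner (Proj K x) d = 0"
        using Proj_diff_in[OF K, of x] Proj_diff_in[OF D, of x] Proj_in[OF K, of x]
          Proj_in[OF D, of x] k d
        by (auto intro: orth_complD)
      then show "cinner (x - (Proj K x + Proj ?D x)) y = 0"
        by (simp add: y cinner_simps)
    qed
  qed
qed

lemma Proj_idem: "closed_csubspace L \<Longrightarrow> Proj L \<circ> Proj L = Proj L"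
  by (auto simp: Proj_fixes Proj_in)

lemma Proj_Proj_orth:
  assumes "closed_csubspace K" "closed_csubspace L" "K \<subseteq> orth_compl L"
  shows "Proj L (Proj K x) = 0" "Proj K (Proj L x) = 0"
proof -
  have "L \<subseteq> orth_compl K"
    using assms(3) by (auto intro!: orth_complI dest: orth_complD(2))
  then show "Proj K (Proj L x) = 0"
    using assms by (intro Proj_orth_eq_zero) (auto intro: Proj_in)
  show "Proj L (Proj K x) = 0"
    using assms by (intro Proj_orth_eq_zero) (auto intro: Proj_in)
qed

text \<open>\<open>T\<close> is injective on \<open>H\<close>, which is orthogonal to
  \<open>ker T\<close>, and maps it into \<open>ker S\<close>. Polar decomposition of
  \<open>T \<circ> Proj H\<close> therefore links \<open>H\<close> to the closure of its
  image.\<close>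

lemma mvn_equiv_kernel_composition:
  fixes S T :: "'a::chilbert_space \<Rightarrow> 'a"
  assumes A: "von_neumann_algebra A" and T: "T \<in> A" and S: "S \<in> A"
  defines "H \<equiv> ker (S \<circ> T) \<inter> orth_compl (ker T)"
  shows "affiliated A H"
    and "is_orth_sum (ker (S \<circ> T)) (ker T) H"
    and "mvn_equiv A (Proj H) (Proj (orth_compl (orth_compl (T ` H))))"
    and "affiliated A (orth_compl (orth_compl (T ` H)))"
    and "orth_compl (orth_compl (T ` H)) \<subseteq> ker S \<inter> orth_compl (orth_compl (range T))"
proof -
  note b = von_neumann_bounded_clinear[OF A]
  note ST = von_neumann_compose[OF A S T]
  show H: "affiliated A H"
    unfolding H_def by (intro affiliated_Int affiliated_orth_compl affiliated_ker A T ST)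
  note cH = affiliated_closed_csubspace[OF H]
  show "is_orth_sum (ker (S \<circ> T)) (ker T) H"
    unfolding H_def
    by (intro is_orth_sum_relative_complement closed_csubspace_ker b T ST)
      (auto simp: ker_def bounded_clinear_zero[OF b[OF S]])
  let ?W = "T \<circ> Proj H"
  have W: "?W \<in> A"
    by (intro von_neumann_compose affiliated_Proj A T H)
  have range_W: "range ?W = T ` H"
  proof
    show "T ` H \<subseteq> range ?W"
      using Proj_fixes[OF cH] by (auto simp: image_iff) metis
  qed (auto intro: Proj_in[OF cH])
  have "ker ?W = orth_compl H"
  proof (intro equalityI subsetI)
    fix x assume "x \<in> ker ?W"
    then have "Proj H x \<in> ker T"
      by (simp add: ker_def)
    moreover have "Proj H x \<in> orth_compl (ker T)"
      using Proj_in[OF cH, of x] by (simp add: H_def)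
    ultimately have "Proj H x = 0"
      by (rule Int_orth_compl)
    then show "x \<in> orth_compl H"
      using Proj_diff_in[OF cH, of x] by simp
  qed (simp add: ker_def Proj_orth_eq_zero[OF cH] bounded_clinear_zero[OF b[OF T]])
  then have "orth_compl (ker ?W) = H"
    by (simp add: orth_compl_orth_compl[OF cH])
  then show "mvn_equiv A (Proj H) (Proj (orth_compl (orth_compl (T ` H))))"
    using mvn_equiv_sym[OF A polar_decomposition_mvn_equiv[OF A W]] by (simp only: range_W)
  show "affiliated A (orth_compl (orth_compl (T ` H)))"
    using affiliated_orth_compl[OF A affiliated_orth_compl_range[OF A W]] by (simp only: range_W)
  show "orth_compl (orth_compl (T ` H)) \<subseteq> ker S \<inter> orth_compl (orth_compl (range T))"
  proof (rule orth_compl_least)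
    show "closed_csubspace (ker S \<inter> orth_compl (orth_compl (range T)))"
      by (intro closed_csubspace_Int closed_csubspace_ker closed_csubspace_orth_compl b S)
    show "T ` H \<subseteq> ker S \<inter> orth_compl (orth_compl (range T))"
      using subset_orth_compl_orth_compl[of "range T"] by (auto simp: H_def ker_def)
  qed
qed

text \<open>A vector is in the kernel exactly when its projection to \<open>N\<close> lies in
  \<open>N \<inter> orth_compl M\<close>. The kernel is thus that space plus the complement of
  \<open>N\<close>, and the rest of \<open>N\<close> is orthogonal to it.\<close>

lemma orth_compl_ker_Proj_Proj:
  assumes M: "closed_csubspace M" and N: "closed_csubspace N"
  shows "orth_compl (ker (Proj M \<circ> Proj N)) = N \<inter> orth_compl (N \<inter> orth_compl M)"
proof (intro equalityI subsetI)
  fix x assume x: "x \<in> orth_compl (ker (Proj M \<circ> Proj N))"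
  have "orth_compl N \<subseteq> ker (Proj M \<circ> Proj N)"
    by (auto simp: ker_def Proj_orth_eq_zero[OF N] bounded_clinear_zero[OF bounded_clinear_Proj[OF M]])
  then have "x \<in> N"
    using x orth_compl_antimono orth_compl_orth_compl[OF N] by blast
  moreover have "N \<inter> orth_compl M \<subseteq> ker (Proj M \<circ> Proj N)"
    by (auto simp: ker_def Proj_fixes[OF N] Proj_orth_eq_zero[OF M])
  then have "x \<in> orth_compl (N \<inter> orth_compl M)"
    using x orth_compl_antimono by blast
  ultimately show "x \<in> N \<inter> orth_compl (N \<inter> orth_compl M)"
    by blast
next
  fix x assume x: "x \<in> N \<inter> orth_compl (N \<inter> orth_compl M)"
  show "x \<in> orth_compl (ker (Proj M \<circ> Proj N))"
  proof (rule orth_complI)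
    fix y assume "y \<in> ker (Proj M \<circ> Proj N)"
    then have "Proj N y \<in> N \<inter> orth_compl M"
      using Proj_in[OF N, of y] Proj_diff_in[OF M, of "Proj N y"] by (simp add: ker_def)
    then have "cinner x (Proj N y) = 0"
      using x by (auto intro: orth_complD)
    then show "cinner x y = 0"
      using x cinner_Proj_swap[OF N, of x y] by (simp add: Proj_fixes[OF N])
  qed
qed

text \<open>The adjoint of \<open>Proj M \<circ> Proj N\<close> is the product in the other order,
  so one kernel computation identifies both the initial and the final space of its polar
  decomposition.\<close>

lemma mvn_equiv_nonorthogonal_parts:
  assumes A: "von_neumann_algebra A" and M: "affiliated A M" and N: "affiliated A N"
  shows "mvn_equiv A (Proj (N \<inter> orth_compl (N \<inter> orth_compl M)))
    (Proj (M \<inter> orth_compl (M \<inter> orth_compl N)))"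
proof -
  note cM = affiliated_closed_csubspace[OF M] and cN = affiliated_closed_csubspace[OF N]
  let ?W = "Proj M \<circ> Proj N"
  have W: "?W \<in> A"
    by (intro von_neumann_compose affiliated_Proj A M N)
  have "adj ?W = Proj N \<circ> Proj M"
    by (simp add: adj_compose bounded_clinear_Proj cM cN adj_Proj)
  then have "orth_compl (orth_compl (range ?W)) = M \<inter> orth_compl (M \<inter> orth_compl N)"
    by (simp only: orth_compl_range[OF von_neumann_bounded_clinear[OF A W]]
        orth_compl_ker_Proj_Proj[OF cN cM])
  then show ?thesis
    using mvn_equiv_sym[OF A polar_decomposition_mvn_equiv[OF A W]]
    by (simp only: orth_compl_ker_Proj_Proj[OF cM cN])
qed

text \<open>Both sides contain \<open>F\<close> and \<open>F'\<close>. What remains is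
  \<open>N'\<close> on one side and \<open>M'\<close> on the other, and these are equivalent by
  \<open>mvn_equiv_nonorthogonal_parts\<close>.\<close>

lemma mvn_equiv_exchange:
  assumes A: "von_neumann_algebra A" and M: "affiliated A M" and N: "affiliated A N"
  shows "mvn_equiv A (\<lambda>x. Proj N x + Proj (M \<inter> orth_compl N) x)
    (\<lambda>x. Proj M x + Proj (N \<inter> orth_compl M) x)"
proof -
  define F where "F = N \<inter> orth_compl M"
  define F' where "F' = M \<inter> orth_compl N"
  define N' where "N' = N \<inter> orth_compl F"
  define M' where "M' = M \<inter> orth_compl F'"
  have aff: "affiliated A F" "affiliated A F'" "affiliated A N'" "affiliated A M'"
    unfolding F_def F'_def N'_def M'_def by (intro affiliated_Int affiliated_orth_compl A M N)+
  note c = aff[THEN affiliated_closed_csubspace]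
  have orth_sym: "K \<subseteq> orth_compl L \<Longrightarrow> L \<subseteq> orth_compl K" for K L :: "'a set"
    by (auto intro!: orth_complI dest: orth_complD(2))
  \<comment> \<open>Orthogonality of the pieces within each side; \<open>N'\<close> and
    \<open>M'\<close> stand on different sides and are never added to each other.\<close>
  have sub: "F \<subseteq> orth_compl F'" "F \<subseteq> orth_compl N'" "F' \<subseteq> orth_compl N'"
    "F \<subseteq> orth_compl M'" "F' \<subseteq> orth_compl M'"
    using orth_compl_antimono[of F' M] orth_compl_antimono[of N' N] orth_compl_antimono[of M' M]
      orth_sym[of N' F] orth_sym[of M' F']
    by (auto simp: F_def F'_def N'_def M'_def)
  note z = Proj_Proj_orth[OF c(1,2) sub(1)] Proj_Proj_orth[OF c(1,3) sub(2)]
    Proj_Proj_orth[OF c(2,3) sub(3)] Proj_Proj_orth[OF c(1,4) sub(4)] Proj_Proj_orth[OF c(2,4) sub(5)]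
  note add = c[THEN bounded_clinear_Proj, THEN bounded_clinear_add]
  note idem = c[THEN Proj_idem]
  note refl = mvn_equiv_refl[OF affiliated_Proj[OF A] is_projection_Proj]
  have "mvn_equiv A (\<lambda>x. Proj F x + Proj F' x) (\<lambda>x. Proj F x + Proj F' x)"
    by (intro mvn_equiv_add A refl aff c idem z)
  moreover have "mvn_equiv A (Proj N') (Proj M')"
    unfolding N'_def M'_def F_def F'_def by (rule mvn_equiv_nonorthogonal_parts[OF A M N])
  ultimately have "mvn_equiv A (\<lambda>x. (Proj F x + Proj F' x) + Proj N' x)
      (\<lambda>x. (Proj F x + Proj F' x) + Proj M' x)"
  proof (rule mvn_equiv_add[OF A])
    show "(\<lambda>x. Proj F x + Proj F' x) \<circ> (\<lambda>x. Proj F x + Proj F' x) = (\<lambda>x. Proj F x + Proj F' x)"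
      using idem by (auto simp: fun_eq_iff add z)
    then show "(\<lambda>x. Proj F x + Proj F' x) \<circ> (\<lambda>x. Proj F x + Proj F' x) = (\<lambda>x. Proj F x + Proj F' x)" .
  qed (simp_all add: idem add z)
  moreover have "Proj N = (\<lambda>x. Proj F x + Proj N' x)"
    unfolding N'_def
    by (rule Proj_relative_complement[OF c(1) affiliated_closed_csubspace[OF N]]) (auto simp: F_def)
  moreover have "Proj M = (\<lambda>x. Proj F' x + Proj M' x)"
    unfolding M'_def
    by (rule Proj_relative_complement[OF c(2) affiliated_closed_csubspace[OF M]]) (auto simp: F'_def)
  ultimately show ?thesis
    by (simp add: F_def[symmetric] F'_def[symmetric] add_ac)
qed

section \<open>The subspaces of a composition and the chain of equivalences\<close>

theorem corollary4p1:
  fixes A :: "('a::chilbert_space \<Rightarrow> 'a) set" and S T :: "'a \<Rightarrow> 'a"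
  assumes "von_neumann_algebra A"
    and "T \<in> A" and "S \<in> A"
    and "closed (range T)" and "closed (range S)" and "closed (range (S \<circ> T))"
  shows "(\<exists>H1 H2. closed_csubspace H1 \<and> closed_csubspace H2 \<and>
            Proj H1 \<in> A \<and> Proj H2 \<in> A \<and>
            is_orth_sum (ker (S \<circ> T)) (ker T) H1 \<and>
            is_orth_sum (orth_compl (range (S \<circ> T))) (orth_compl (range S)) H2 \<and>
            mvn_subequiv A (Proj H1) (Proj (ker S)) \<and>
            mvn_subequiv A (Proj H2) (Proj (orth_compl (range T)))) \<and>
         (mvn_equiv A (Proj (ker T)) (Proj (orth_compl (range T))) \<and>
          mvn_equiv A (Proj (ker S)) (Proj (orth_compl (range S))) \<longrightarrow>
          mvn_equiv A (Proj (ker (S \<circ> T))) (Proj (orth_compl (range (S \<circ> T)))))"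
proof -
  note A = assms(1) and T = assms(2) and S = assms(3)
  note ST = von_neumann_compose[OF A S T]
  note b = von_neumann_bounded_clinear[OF A]
  note aT = von_neumann_adj[OF A T] and aS = von_neumann_adj[OF A S]
  define M where "M = ker S"
  define N where "N = orth_compl (range T)"
  define H1 where "H1 = ker (S \<circ> T) \<inter> orth_compl (ker T)"
  define H2 where "H2 = ker (adj T \<circ> adj S) \<inter> orth_compl (ker (adj S))"
  define D1 where "D1 = orth_compl (orth_compl (T ` H1))"
  define D2 where "D2 = orth_compl (orth_compl (adj S ` H2))"
  have N_ker: "N = ker (adj T)"
    by (simp add: N_def orth_compl_range b T)
  have oS: "orth_compl (range S) = ker (adj S)"
    by (simp add: orth_compl_range b S)
  have oST: "orth_compl (range (S \<circ> T)) = ker (adj T \<circ> adj S)"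
    by (simp only: orth_compl_range[OF b[OF ST]] adj_compose b S T)
  have oM: "orth_compl M = orth_compl (orth_compl (range (adj S)))"
    by (simp add: M_def orth_compl_range b aS adj_adj S)
  note h1 = mvn_equiv_kernel_composition[OF A T S, folded H1_def, folded D1_def]
  \<comment> \<open>Here \<open>adj S\<close> takes the place of \<open>T\<close> and
    \<open>adj T\<close> that of \<open>S\<close>, because complements of images are kernels of
    adjoints.\<close>
  note h2 = mvn_equiv_kernel_composition[OF A aS aT, folded H2_def, folded D2_def]
  have affM: "affiliated A M" and affN: "affiliated A N"
    by (simp_all add: M_def N_def affiliated_ker affiliated_orth_compl_range A S T)
  note cM = affiliated_closed_csubspace[OF affM] and cN = affiliated_closed_csubspace[OF affN]
  note cH1 = affiliated_closed_csubspace[OF h1(1)] and cD1 = affiliated_closed_csubspace[OF h1(4)]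
  note cH2 = affiliated_closed_csubspace[OF h2(1)] and cD2 = affiliated_closed_csubspace[OF h2(4)]
  have D1_sub: "D1 \<subseteq> M \<inter> orth_compl N"
    using h1(5) by (simp add: M_def N_def)
  have D2_sub: "D2 \<subseteq> N \<inter> orth_compl M"
    using h2(5) by (simp add: oM N_ker)
  \<comment> \<open>The projection below \<open>Proj (ker S)\<close> is \<open>Proj D1\<close>; for
    \<open>H2\<close> it is \<open>Proj D2\<close>.\<close>
  have "mvn_subequiv A (Proj H1) (Proj (ker S))"
    unfolding mvn_subequiv_def
    using affiliated_Proj[OF A h1(4)] is_projection_Proj[OF cD1] op_le_Proj[OF cD1 cM] D1_sub h1(3)
    by (auto simp: M_def)
  moreover have "mvn_subequiv A (Proj H2) (Proj (orth_compl (range T)))"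
    unfolding mvn_subequiv_def
    using affiliated_Proj[OF A h2(4)] is_projection_Proj[OF cD2] op_le_Proj[OF cD2 cN] D2_sub h2(3)
    by (auto simp: N_def)
  moreover have "mvn_equiv A (Proj (ker (S \<circ> T))) (Proj (orth_compl (range (S \<circ> T))))"
    if eT: "mvn_equiv A (Proj (ker T)) (Proj N)"
      and eS: "mvn_equiv A (Proj M) (Proj (ker (adj S)))"
  proof -
    have D1_eq: "D1 = M \<inter> orth_compl N"
    proof
      show "M \<inter> orth_compl N \<subseteq> D1"
      proof
        fix z assume z: "z \<in> M \<inter> orth_compl N"
        \<comment> \<open>Closedness of the range gives each vector orthogonal to \<open>N\<close>
          an exact preimage under \<open>T\<close>.\<close>
        have "orth_compl N = range T"
          unfolding N_def by (intro orth_compl_orth_compl closed_csubspace_range b T assms(4))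
        then obtain w where w: "z = T w"
          using z by auto
        \<comment> \<open>The component of \<open>w\<close> orthogonal to \<open>ker T\<close> has
          the same image \<open>z\<close>, which \<open>S\<close> kills; hence it lies in
          \<open>H1\<close>.\<close>
        let ?u = "w - Proj (ker T) w"
        have "Proj (ker T) w \<in> ker T"
          by (intro Proj_in closed_csubspace_ker b T)
        then have Tu: "T ?u = z"
          by (simp add: w bounded_clinear_diff[OF b[OF T]] ker_def)
        have "?u \<in> H1"
          using Proj_diff_in[OF closed_csubspace_ker[OF b[OF T]], of w] z Tu
          by (simp add: H1_def ker_def M_def)
        then show "z \<in> D1"
          using Tu subset_orth_compl_orth_compl[of "T ` H1"] by (force simp: D1_def)
      qed
    qed (rule D1_sub)
    have D2_eq: "D2 = N \<inter> orth_compl M"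
    proof
      show "N \<inter> orth_compl M \<subseteq> D2"
      proof
        fix y assume y: "y \<in> N \<inter> orth_compl M"
        \<comment> \<open>The part of \<open>y\<close> orthogonal to \<open>D2\<close>; once it is
          shown to be zero, \<open>y\<close> lies in \<open>D2\<close>.\<close>
        define z where "z = y - Proj D2 y"
        have z: "z \<in> N" "z \<in> orth_compl M"
          using y D2_sub Proj_in[OF cD2, of y] cN
          by (auto simp: z_def intro!: closed_csubspace_diff closed_csubspace_orth_compl)
        have zD: "z \<in> orth_compl (adj S ` H2)"
          using Proj_diff_in[OF cD2, of y] by (simp add: z_def D2_def orth_compl_triple)
        \<comment> \<open>The complement of the image of \<open>S \<circ> T\<close> is
          \<open>ker (adj S)\<close> plus \<open>H2\<close>. \<open>S z\<close> is orthogonal to the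
          first as a value of \<open>S\<close> and to the second by \<open>zD\<close>.\<close>
        have "S z \<in> orth_compl (orth_compl (range (S \<circ> T)))"
        proof (rule orth_complI)
          fix v assume "v \<in> orth_compl (range (S \<circ> T))"
          then obtain p q where v: "v = p + q" and p: "p \<in> ker (adj S)" and q: "q \<in> H2"
            using h2(2) unfolding oST by (blast elim: is_orth_sumE)
          show "cinner (S z) v = 0"
            using p q zD
            by (simp add: v cinner_simps cinner_adj[OF b[OF S]] ker_def orth_complD)
        qed
        also have "\<dots> = range (S \<circ> T)"
          by (intro orth_compl_orth_compl closed_csubspace_range b ST assms(6))
        \<comment> \<open>The closed image now contains \<open>S z\<close>. So
          \<open>z - T w\<close> is in \<open>M\<close>, to which \<open>z\<close> is orthogonal;
          being in \<open>N\<close>, \<open>z\<close> is also orthogonal to \<open>T w\<close>,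
          hence to itself.\<close>
        finally obtain w where "S z = S (T w)"
          by auto
        then have "z - T w \<in> M"
          by (simp add: M_def ker_def bounded_clinear_diff[OF b[OF S]])
        then have "cinner z (z - T w) = 0"
          by (rule orth_complD[OF z(2)])
        moreover have "cinner z (T w) = 0"
          using z(1) by (auto simp: N_def intro: orth_complD)
        ultimately have "z = 0"
          by (simp add: cinner_simps cinner_self_eq_zero)
        then show "y \<in> D2"
          using Proj_in[OF cD2, of y] by (simp add: z_def)
      qed
    qed (rule D2_sub)
    have cT: "closed_csubspace (ker T)" and cS: "closed_csubspace (ker (adj S))"
      and cST: "closed_csubspace (ker (S \<circ> T))" and caST: "closed_csubspace (ker (adj T \<circ> adj S))"
      by (intro closed_csubspace_ker b T aS ST von_neumann_compose[OF A aT aS])+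
    have orth: "H1 \<subseteq> orth_compl (ker T)" "H2 \<subseteq> orth_compl (ker (adj S))"
      "D1 \<subseteq> orth_compl N" "D2 \<subseteq> orth_compl M"
      using D1_sub D2_sub by (auto simp: H1_def H2_def)
    note z = Proj_Proj_orth[OF cH1 cT orth(1)] Proj_Proj_orth[OF cH2 cS orth(2)]
      Proj_Proj_orth[OF cD1 cN orth(3)] Proj_Proj_orth[OF cD2 cM orth(4)]
    have kST: "Proj (ker (S \<circ> T)) = (\<lambda>x. Proj (ker T) x + Proj H1 x)"
      unfolding H1_def
      by (rule Proj_relative_complement[OF cT cST]) (auto simp: ker_def bounded_clinear_zero b S)
    have rST: "Proj (ker (adj T \<circ> adj S)) = (\<lambda>x. Proj (ker (adj S)) x + Proj H2 x)"
      unfolding H2_def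
      by (rule Proj_relative_complement[OF cS caST]) (auto simp: ker_def bounded_clinear_zero b aT)
    have idem: "(\<lambda>x. Proj M x + Proj D2 x) \<circ> (\<lambda>x. Proj M x + Proj D2 x) = (\<lambda>x. Proj M x + Proj D2 x)"
      using Proj_idem[OF cM] Proj_idem[OF cD2] z
      by (auto simp: fun_eq_iff bounded_clinear_add bounded_clinear_Proj cM cD2)
    \<comment> \<open>First \<open>ker T\<close> is traded for \<open>N\<close> and
      \<open>H1\<close> for \<open>D1\<close>; the exchange passes to \<open>M\<close> and
      \<open>D2\<close>; then \<open>M\<close> is traded for \<open>ker (adj S)\<close> and
      \<open>D2\<close> for \<open>H2\<close>.\<close>
    have "mvn_equiv A (Proj (ker (S \<circ> T))) (\<lambda>x. Proj N x + Proj D1 x)"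
      unfolding kST by (intro mvn_equiv_add A eT h1(3) Proj_idem cT cH1 cN cD1 z)
    then have "mvn_equiv A (Proj (ker (S \<circ> T))) (\<lambda>x. Proj M x + Proj D2 x)"
      using mvn_equiv_trans[OF A _ mvn_equiv_exchange[OF A affM affN, folded D1_eq D2_eq]
          Proj_idem[OF cST] idem] by blast
    moreover have "mvn_equiv A (\<lambda>x. Proj M x + Proj D2 x) (Proj (ker (adj T \<circ> adj S)))"
      unfolding rST
      by (intro mvn_equiv_add A eS mvn_equiv_sym[OF A h2(3)] Proj_idem cM cD2 cS cH2 z)
    ultimately show ?thesis
      unfolding oST by (rule mvn_equiv_trans[OF A _ _ Proj_idem[OF cST] Proj_idem[OF caST]])
  qed
  ultimately show ?thesis
    using cH1 cH2 affiliated_Proj[OF A h1(1)] affiliated_Proj[OF A h2(1)] h1(2) h2(2)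
    unfolding M_def[symmetric] N_def[symmetric] oS oST by blast
qed

end
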